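(* Let $f_1,\dots,f_m:\mathbb{R}^d\to\mathbb{R}$ each be $\mu$-strongly convex and $L$-smooth with $\mu>0$, let $\kappa=L/\mu$, let $G:\mathbb{R}^d\to\mathbb{R}\cup\{\pm\infty\}$ be proper, closed and convex, and let $x^\star$ be the optimal solution of $\min_{x\in\mathbb{R}^d}\frac1m\sum_{i=1}^m f_i(x)+G(x)$. Let $A\in\mathbb{R}^{m\times m}$, $B,C\in\mathbb{S}^m$ and $\gamma$ satisfy: (i) $A=BD$ with $D\in\mathbb{S}^m$, $0\prec D\preceq I$; (ii) $1^\top D1=m$ and $1^\top B=1^\top$; (iii) $0\preceq C\prec I$ and $\mathrm{Null}(C)=\mathrm{span}(1)$; (iv) $B$ and $C$ commute; (v) $q(D,\gamma)^2B^2\prec I-C$ and $0<\gamma\le\gamma^\star(D)$, where $$\gamma^\star(D)=\frac{2\lambda_{\min}(D)}{L+\mu\lambda_{\min}(D)},\qquad q(D,\gamma)=\sqrt{1-\frac{2\gamma L}{\kappa+\lambda_{\min}(D)}},$$ and assume further that $B^2\preceq I-C$. Let $Z^0\in\mathbb{R}^{m\times d}$ be arbitrary, $Y^0=0$, and for $k\ge0$ $$X^k=\mathrm{prox}_{\gamma g}(Z^k),\qquad Z^{k+1}=AX^k-\gamma B\nabla f(X^k)-Y^k,\qquad Y^{k+1}=Y^k+CZ^{k+1}.$$ Then: (a) $\|X^k-1x^{\star\top}\|^2=\mathcal{O}(\delta^k)$ with $\delta=\max\big(q(D,\gamma)^2,\,1-\lambda_2(C)\big)$. (b) Over $\gamma\in(0,\gamma^\star(D)]$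 this $\delta$ is minimized at $\gamma=\gamma^\star(D)$, where it equals $$\max\left(\Big(\frac{\kappa-\lambda_{\min}(D)}{\kappa+\lambda_{\min}(D)}\Big)^2,\;1-\lambda_2(C)\right).$$ (c) Over all $D\in\mathbb{S}^m$ with $0\prec D\preceq I$ and $1^\top D1=m$, the value in (b) is smallest for $D=I$, in which case $\gamma^\star(I)=\frac{2}{\mu+L}$ and the value is $$\delta^\star=\max\left\{\Big(\frac{\kappa-1}{\kappa+1}\Big)^2,\;1-\lambda_2(C)\right\}.$$
   Context: $\mathbb{S}^m$ is the set of real symmetric $m\times m$ matrices; $\preceq,\prec$ denote the Loewner order. $1\in\mathbb{R}^m$ is the all-ones vector. For $X=[x_1,\dots,x_m]^\top\in\mathbb{R}^{m\times d}$ (row $i$ is $x_i^\top$), $f(X)=\sum_{i=1}^m f_i(x_i)$, $g(X)=\sum_{i=1}^m G(x_i)$, $\nabla f(X)=[\nabla f_1(x_1),\dots,\nabla f_m(x_m)]^\top$, and $\mathrm{prox}_{\gamma g}(X)=\arg\min_{Y\in\mathbb{R}^{m\times d}} g(Y)+\frac1{2\gamma}\|X-Y\|^2$. "$L$-smooth" means differentiable with $L$-Lipschitz gradient. $\|\cdot\|$ is the Frobenius norm. $\lambda_{\min}$ is the smallest eigenvalue and $\lambda_2(C)$ the second smallest eigenvalue of $C$. *)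

theory Defs
  imports "HOL-Analysis.Analysis" "HOL-Library.Landau_Symbols"
begin

definition symmetric_mat :: "real^'n^'n \<Rightarrow> bool" where
  "symmetric_mat M \<longleftrightarrow> transpose M = M"

definition psd :: "real^'n^'n \<Rightarrow> bool" where
  "psd M \<longleftrightarrow> symmetric_mat M \<and> (\<forall>v. 0 \<le> v \<bullet> (M *v v))"

definition pd :: "real^'n^'n \<Rightarrow> bool" where
  "pd M \<longleftrightarrow> symmetric_mat M \<and> (\<forall>v. v \<noteq> 0 \<longrightarrow> 0 < v \<bullet> (M *v v))"

definition loewner_le :: "real^'n^'n \<Rightarrow> real^'n^'n \<Rightarrow> bool" (infix \<open>\<preceq>\<^sub>L\<close> 50) where
  "M \<preceq>\<^sub>L N \<longleftrightarrow> psd (N - M)"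

definition loewner_less :: "real^'n^'n \<Rightarrow> real^'n^'n \<Rightarrow> bool" (infix \<open>\<prec>\<^sub>L\<close> 50) where
  "M \<prec>\<^sub>L N \<longleftrightarrow> pd (N - M)"

definition null_space :: "real^'n^'n \<Rightarrow> (real^'n) set" where
  "null_space M = {v. M *v v = 0}"

definition eigenspace :: "real^'n^'n \<Rightarrow> real \<Rightarrow> (real^'n) set" where
  "eigenspace M l = {v. M *v v = l *\<^sub>R v}"

definition eigenvalues :: "real^'n^'n \<Rightarrow> real set" where
  "eigenvalues M = {l. \<exists>v. v \<noteq> 0 \<and> v \<in> eigenspace M l}"

definition lambda_min :: "real^'n^'n \<Rightarrow> real" where
  "lambda_min M = Min (eigenvalues M)"

text \<open>The eigenvalues in increasing order, each repeated according to its geometric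
  multiplicity; for symmetric matrices this is also the algebraic one, and the list has
  length \<open>CARD('n)\<close>.\<close>

definition eigenvalue_list :: "real^'n^'n \<Rightarrow> real list" where
  "eigenvalue_list M =
     concat (map (\<lambda>l. replicate (dim (eigenspace M l)) l) (sorted_list_of_set (eigenvalues M)))"

text \<open>List positions start at 0. The value is meaningful only for matrices of size at least 2.\<close>

definition lambda_2 :: "real^'n^'n \<Rightarrow> real" where
  "lambda_2 M = eigenvalue_list M ! 1"

definition gradient :: "('a::real_inner \<Rightarrow> real) \<Rightarrow> 'a \<Rightarrow> 'a" where
  "gradient f x = (THE D. GDERIV f x :> D)"

definition L_smooth :: "real \<Rightarrow> ('a::real_inner \<Rightarrow> real) \<Rightarrow> bool" where
  "L_smooth L f \<longleftrightarrow> (\<forall>x. f differentiable (at x)) \<and> L-lipschitz_on UNIV (gradient f)"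

definition strongly_convex :: "real \<Rightarrow> ('a::real_inner \<Rightarrow> real) \<Rightarrow> bool" where
  "strongly_convex \<mu> f \<longleftrightarrow>
     (\<forall>x y. \<forall>t\<in>{0..1}. f (t *\<^sub>R x + (1 - t) *\<^sub>R y)
        \<le> t * f x + (1 - t) * f y - \<mu> / 2 * t * (1 - t) * (norm (x - y))\<^sup>2)"

text \<open>The epigraph of an extended-real function lives in \<open>'a \<times> \<real>\<close>; the library's
  \<open>epigraph\<close> only covers real-valued functions.\<close>

definition epigraph_ext :: "('a \<Rightarrow> ereal) \<Rightarrow> ('a \<times> real) set" where
  "epigraph_ext G = {(x, r). G x \<le> ereal r}"

definition proper_fun :: "('a \<Rightarrow> ereal) \<Rightarrow> bool" where
  "proper_fun G \<longleftrightarrow> (\<exists>x. G x < \<infinity>) \<and> (\<forall>x. G x \<noteq> -\<infinity>)"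

definition closed_fun :: "('a::real_normed_vector \<Rightarrow> ereal) \<Rightarrow> bool" where
  "closed_fun G \<longleftrightarrow> closed (epigraph_ext G)"

definition convex_fun :: "('a::real_vector \<Rightarrow> ereal) \<Rightarrow> bool" where
  "convex_fun G \<longleftrightarrow> convex (epigraph_ext G)"

definition prox :: "real \<Rightarrow> ('a::real_normed_vector \<Rightarrow> ereal) \<Rightarrow> 'a \<Rightarrow> 'a" where
  "prox \<gamma> g x = arg_min (\<lambda>y. g y + ereal (1 / (2 * \<gamma>) * (norm (x - y))\<^sup>2)) (\<lambda>_. True)"

text \<open>Elements of \<open>real^'d^'m\<close> are \<open>m \<times> d\<close> matrices with rows \<open>X $ i\<close>;
  \<open>norm\<close> on this type is the Frobenius norm.\<close>

definition sep_sum :: "(real^'d \<Rightarrow> ereal) \<Rightarrow> real^'d^'m \<Rightarrow> ereal" where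
  "sep_sum G X = (\<Sum>i\<in>UNIV. G (X $ i))"

definition stacked_gradient :: "('m \<Rightarrow> real^'d \<Rightarrow> real) \<Rightarrow> real^'d^'m \<Rightarrow> real^'d^'m" where
  "stacked_gradient f X = (\<chi> i. gradient (f i) (X $ i))"

definition gamma_star :: "real \<Rightarrow> real \<Rightarrow> real^'m^'m \<Rightarrow> real" where
  "gamma_star \<mu> L D = 2 * lambda_min D / (L + \<mu> * lambda_min D)"

definition q_factor :: "real \<Rightarrow> real \<Rightarrow> real^'m^'m \<Rightarrow> real \<Rightarrow> real" where
  "q_factor \<mu> L D \<gamma> = sqrt (1 - 2 * \<gamma> * L / (L / \<mu> + lambda_min D))"

definition rate :: "real \<Rightarrow> real \<Rightarrow> real^'m^'m \<Rightarrow> real^'m^'m \<Rightarrow> real \<Rightarrow> real" where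
  "rate \<mu> L C D \<gamma> = max ((q_factor \<mu> L D \<gamma>)\<^sup>2) (1 - lambda_2 C)"

end

theory Submission
  imports Defs
begin

text \<open>With \<open>p = (1/m) \<Sum>\<^sub>i \<nabla>f\<^sub>i(x\<^sup>\<star>)\<close>, optimality of \<open>x\<^sup>\<star>\<close> says \<open>-p \<in> \<partial>G(x\<^sup>\<star>)\<close>, so the iteration has the fixed
  point \<open>X\<^sup>\<star> = 1 x\<^sup>\<star>\<^sup>T\<close>, \<open>Z\<^sup>\<star> = 1 (x\<^sup>\<star> - \<gamma> p)\<^sup>T\<close>, with a \<open>Y\<^sup>\<star>\<close> whose columns are orthogonal to \<open>1\<close>, hence lie in
  the range of \<open>C\<close>. Write \<open>Y\<^sup>k - Y\<^sup>\<star> = C U\<^sup>k\<close> and \<open>W = (I - C)\<inverse>\<close>. The Lyapunov function is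
  \<open>V\<^sup>k = \<parallel>Z\<^sup>k - Z\<^sup>\<star>\<parallel>\<^sup>2 + \<langle>U\<^sup>k, C W U\<^sup>k\<rangle>\<close>: if \<open>T\<close> denotes the difference of the gradient steps
  \<open>D X - \<gamma> \<nabla>f(X)\<close> at \<open>X\<^sup>k\<close> and \<open>X\<^sup>\<star>\<close>, then \<open>V\<^sup>k\<^sup>+\<^sup>1 = \<langle>B T, W B T\<rangle> + \<langle>U\<^sup>k, C U\<^sup>k\<rangle>\<close> exactly.
  The first term is at most \<open>\<parallel>T\<parallel>\<^sup>2 \<le> q\<^sup>2 \<parallel>X\<^sup>k - X\<^sup>\<star>\<parallel>\<^sup>2 \<le> q\<^sup>2 \<parallel>Z\<^sup>k - Z\<^sup>\<star>\<parallel>\<^sup>2\<close> since \<open>B\<^sup>2 \<preceq> I - C\<close> and the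
  proximal map is nonexpansive; the second is at most \<open>(1 - \<lambda>\<^sub>2(C)) \<langle>U\<^sup>k, C W U\<^sup>k\<rangle>\<close>.\<close>

text \<open>Serves wherever a first-order condition is extracted: perturb by a step
  \<open>t\<close>, divide by \<open>t\<close>, and let \<open>t\<close> tend to 0 from the
  right.\<close>

lemma le_zero_if_le_small_mult:
  fixes a b :: real
  assumes "\<And>t. 0 < t \<Longrightarrow> t < 1 \<Longrightarrow> a \<le> t * b"
  shows "a \<le> 0"
proof (rule tendsto_le)
  show "((\<lambda>t. t * b) \<longlongrightarrow> 0) (at_right 0)"
    by (auto intro!: tendsto_eq_intros)
  show "((\<lambda>t. a) \<longlongrightarrow> a) (at_right (0::real))" by simp
  show "\<forall>\<^sub>F t in at_right 0. a \<le> t * b"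
    unfolding eventually_at_right_field using assms by (intro exI[of _ 1]) auto
qed simp

section \<open>Rayleigh quotients and semidefinite matrices\<close>

lemma inner_le_zero_iff [simp]: "x \<bullet> x \<le> 0 \<longleftrightarrow> x = 0" for x :: "'a::real_inner"
  by (metis inner_eq_zero_iff inner_ge_zero order_antisym order_refl)

lemma symmetric_mat_inner:
  "symmetric_mat M \<Longrightarrow> u \<bullet> (M *v v) = (M *v u) \<bullet> v"
  by (metis dot_lmul_matrix symmetric_mat_def vector_transpose_matrix)

lemma symmetric_mat_mult:
  "symmetric_mat M \<Longrightarrow> symmetric_mat N \<Longrightarrow> M ** N = N ** M \<Longrightarrow> symmetric_mat (M ** N)"
  by (simp add: symmetric_mat_def matrix_transpose_mul)

lemma matrix_sub_ldistrib: "A ** (B - C) = A ** B - A ** C" for A :: "real^'n^'m"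
  by (vector matrix_matrix_mult_def sum_subtractf right_diff_distrib)

lemma matrix_sub_rdistrib: "(A - B) ** C = A ** C - B ** C" for A :: "real^'n^'m"
  by (vector matrix_matrix_mult_def sum_subtractf left_diff_distrib)

lemma symmetric_mat_1 [simp]: "symmetric_mat (mat 1)"
  by (simp add: symmetric_mat_def transpose_mat)

lemma symmetric_mat_diff:
  "symmetric_mat M \<Longrightarrow> symmetric_mat N \<Longrightarrow> symmetric_mat (M - N)"
  by (simp add: symmetric_mat_def transpose_def vec_eq_iff)

lemma symmetric_mat_scaleR: "symmetric_mat M \<Longrightarrow> symmetric_mat (a *\<^sub>R M)"
  by (simp add: symmetric_mat_def transpose_def vec_eq_iff)

text \<open>Compactness of the unit sphere of \<open>S\<close> gives a minimiser \<open>v\<close> of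
  the quadratic form, and stationarity along the residual \<open>M v - l v\<close>, which invariance
  keeps in \<open>S\<close>, makes \<open>v\<close> an eigenvector. Working inside an invariant
  subspace allows the argument to be repeated inside an eigenspace.\<close>

lemma rayleigh_minimum:
  fixes M :: "real^'n^'n"
  assumes S: "subspace S" "S \<noteq> {0}" and M: "symmetric_mat M"
    and inv: "\<And>v. v \<in> S \<Longrightarrow> M *v v \<in> S"
  obtains v l where "v \<in> S" "v \<noteq> 0" "M *v v = l *\<^sub>R v"
    "\<And>w. w \<in> S \<Longrightarrow> l * (norm w)\<^sup>2 \<le> w \<bullet> (M *v w)"
proof -
  let ?K = "S \<inter> sphere 0 1"
  have K: "compact ?K" using closed_subspace[OF S(1)] by (intro closed_Int_compact) auto
  from S obtain u where u: "u \<in> S" "u \<noteq> 0" using subspace_0 by fastforce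
  have "(1 / norm u) *\<^sub>R u \<in> ?K" using S(1) u by (auto intro: subspace_scale)
  then have ne: "?K \<noteq> {}" by blast
  have "continuous_on ?K (\<lambda>v. v \<bullet> (M *v v))"
    by (intro continuous_intros linear_continuous_on linear_conv_bounded_linear[THEN iffD1]) auto
  from continuous_attains_inf[OF K ne this] obtain v
    where v: "v \<in> ?K" and min: "\<And>w. w \<in> ?K \<Longrightarrow> v \<bullet> (M *v v) \<le> w \<bullet> (M *v w)" by auto
  define l where "l = v \<bullet> (M *v v)"
  have low: "l * (norm w)\<^sup>2 \<le> w \<bullet> (M *v w)" if w: "w \<in> S" for w
  proof (cases "w = 0")
    case False
    let ?u = "(1 / norm w) *\<^sub>R w"
    have "?u \<in> ?K" using S(1) w False by (auto intro: subspace_scale)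
    from min[OF this] have "l \<le> (1 / norm w) * (1 / norm w) * (w \<bullet> (M *v w))"
      by (simp add: l_def matrix_vector_mult_scaleR)
    then show ?thesis using False by (simp add: field_simps power2_eq_square)
  qed simp
  define r where "r = M *v v - l *\<^sub>R v"
  have r: "r \<in> S" unfolding r_def using v inv S(1) by (auto intro: subspace_diff subspace_scale)
  have vv: "v \<bullet> v = 1" using v by (simp add: norm_eq_1)
  \<comment> \<open>Compare \<open>v\<close> with \<open>v - t r\<close>. The terms in
    \<open>r \<bullet> v\<close> cancel, so the first-order part in \<open>t\<close> is exactly
    \<open>2 (r \<bullet> r)\<close>.\<close>
  have "2 * (r \<bullet> r) \<le> t * (r \<bullet> (M *v r) - l * (r \<bullet> r))" if t: "0 < t" "t < 1" for t
  proof -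
    have "v - t *\<^sub>R r \<in> S" using v r S(1) by (auto intro: subspace_diff subspace_scale)
    from low[OF this]
    have "l * ((v - t *\<^sub>R r) \<bullet> (v - t *\<^sub>R r)) \<le> (v - t *\<^sub>R r) \<bullet> (M *v (v - t *\<^sub>R r))"
      by (simp add: power2_norm_eq_inner)
    also have "\<dots> = l - 2 * t * (r \<bullet> (M *v v)) + t * t * (r \<bullet> (M *v r))"
      using symmetric_mat_inner[OF M, of v r]
      by (simp add: algebra_simps inner_diff_left inner_diff_right l_def inner_commute)
    also have "r \<bullet> (M *v v) = r \<bullet> r + l * (r \<bullet> v)"
      by (simp add: r_def inner_diff_right)
    finally have "t * (2 * (r \<bullet> r)) \<le> t * (t * (r \<bullet> (M *v r) - l * (r \<bullet> r)))"
      using vv by (simp add: algebra_simps inner_diff_left inner_diff_right inner_commute)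
    then show ?thesis using t by simp
  qed
  from le_zero_if_le_small_mult[OF this] have "r = 0" by (simp add: inner_le_zero_iff)
  then have "M *v v = l *\<^sub>R v" by (simp add: r_def)
  moreover have "v \<noteq> 0" using vv by auto
  ultimately show ?thesis using that[of v l] low v by blast
qed

lemma rayleigh_minimum_UNIV:
  fixes M :: "real^'n^'n"
  assumes "symmetric_mat M"
  obtains v l where "v \<noteq> 0" "M *v v = l *\<^sub>R v"
    "\<And>w. l * (norm w)\<^sup>2 \<le> w \<bullet> (M *v w)"
proof -
  have "(UNIV :: (real^'n) set) \<noteq> {0}" by (metis UNIV_not_singleton)
  from rayleigh_minimum[OF subspace_UNIV this assms] show ?thesis using that by auto
qed

lemma subspace_eigenspace: "subspace (eigenspace M l)"
  by (auto simp: subspace_def eigenspace_def matrix_vector_right_distrib scaleR_add_right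
      matrix_vector_mult_scaleR)

text \<open>Minimising over an eigenspace of \<open>M\<close> that \<open>P\<close> preserves gives a common eigenvector.\<close>

lemma psd_if_commutes:
  fixes M P :: "real^'n^'n"
  assumes M: "symmetric_mat M" and P: "symmetric_mat P" and comm: "M ** P = P ** M"
    and ev: "\<And>v l p. v \<noteq> 0 \<Longrightarrow> M *v v = l *\<^sub>R v \<Longrightarrow> P *v v = p *\<^sub>R v \<Longrightarrow> 0 \<le> l"
  shows "psd M"
proof -
  from rayleigh_minimum_UNIV[OF M] obtain u l
    where u: "u \<noteq> 0" "M *v u = l *\<^sub>R u" and low: "\<And>w. l * (norm w)\<^sup>2 \<le> w \<bullet> (M *v w)" by blast
  have "u \<in> eigenspace M l" using u by (simp add: eigenspace_def)
  then have ne: "eigenspace M l \<noteq> {0}" using u by blast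
  have inv: "P *v v \<in> eigenspace M l" if "v \<in> eigenspace M l" for v
    using that
    by (simp add: eigenspace_def matrix_vector_mul_assoc comm flip: matrix_vector_mult_scaleR)
       (simp flip: matrix_vector_mul_assoc)
  from rayleigh_minimum[OF subspace_eigenspace ne P inv] obtain v p
    where "v \<in> eigenspace M l" "v \<noteq> 0" "P *v v = p *\<^sub>R v" by blast
  with ev[of v l p] have "0 \<le> l" by (simp add: eigenspace_def)
  with low show ?thesis
    by (metis M mult_nonneg_nonneg order_trans psd_def zero_le_power2)
qed

text \<open>On a common eigenvector of \<open>P ** Q\<close> and \<open>P\<close>, the eigenvalue of
  the product is the eigenvalue of \<open>P\<close> times the Rayleigh quotient of \<open>Q\<close>,
  and both factors are nonnegative.\<close>

lemma psd_mult:
  assumes P: "psd P" and Q: "psd Q" and comm: "P ** Q = Q ** P"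
  shows "psd (P ** Q)"
proof (rule psd_if_commutes[where P = P])
  show "symmetric_mat P" "symmetric_mat (P ** Q)"
    using assms by (auto simp: psd_def intro: symmetric_mat_mult)
  show "P ** Q ** P = P ** (P ** Q)" using comm by (simp add: matrix_mul_assoc)
  fix v l p assume v: "v \<noteq> 0" "(P ** Q) *v v = l *\<^sub>R v" "P *v v = p *\<^sub>R v"
  have "p * (v \<bullet> v) = v \<bullet> (P *v v)" using v by simp
  also have "\<dots> \<ge> 0" using P by (simp add: psd_def)
  finally have p: "0 \<le> p" using v by (simp add: zero_le_mult_iff)
  have "l *\<^sub>R v = p *\<^sub>R (Q *v v)"
    using v by (metis comm matrix_vector_mul_assoc matrix_vector_mult_scaleR)
  then have "l * (v \<bullet> v) = p * (v \<bullet> (Q *v v))" by (metis inner_scaleR_right)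
  also have "\<dots> \<ge> 0" using Q p by (simp add: psd_def)
  finally show "0 \<le> l" using v by (simp add: zero_le_mult_iff)
qed

section \<open>The spectrum of a symmetric matrix: finiteness, smallest and second smallest
  eigenvalue\<close>

lemma finite_eigenvalues:
  assumes M: "symmetric_mat M"
  shows "finite (eigenvalues M)"
proof -
  define w where "w l = (SOME v. v \<noteq> 0 \<and> v \<in> eigenspace M l)" for l
  have w: "w l \<noteq> 0" "M *v w l = l *\<^sub>R w l" if "l \<in> eigenvalues M" for l
    using someI_ex[of "\<lambda>v. v \<noteq> 0 \<and> v \<in> eigenspace M l"] that
    unfolding w_def[symmetric] by (auto simp: eigenvalues_def eigenspace_def)
  have inj: "inj_on w (eigenvalues M)"
    by (rule inj_onI) (metis w scaleR_cancel_right)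
  have orth: "w l \<bullet> w k = 0" if "l \<in> eigenvalues M" "k \<in> eigenvalues M" "l \<noteq> k" for l k
  proof -
    have "k * (w l \<bullet> w k) = l * (w l \<bullet> w k)"
      using symmetric_mat_inner[OF M, of "w l" "w k"] w that by simp
    then show ?thesis using that by simp
  qed
  \<comment> \<open>One eigenvector per eigenvalue gives an orthogonal family of nonzero vectors,
    hence a finite one. Finiteness is what gives \<open>Min\<close> its meaning in
    \<open>lambda_min\<close>.\<close>
  have "independent (w ` eigenvalues M)"
    by (rule pairwise_orthogonal_independent)
       (use w orth in \<open>fastforce simp: pairwise_def orthogonal_def\<close>)+
  then have "finite (w ` eigenvalues M)" by (rule independent_imp_finite)
  then show ?thesis using inj by (rule finite_imageD)
qed

text \<open>The minimum of the Rayleigh quotient is itself an eigenvalue, so the least eigenvalue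
  cannot exceed it.\<close>

lemma lambda_min_rayleigh:
  assumes M: "symmetric_mat M"
  shows "lambda_min M \<in> eigenvalues M" and "lambda_min M * (norm w)\<^sup>2 \<le> w \<bullet> (M *v w)"
proof -
  from rayleigh_minimum_UNIV[OF M] obtain u l
    where u: "u \<noteq> 0" "M *v u = l *\<^sub>R u" and low: "\<And>w. l * (norm w)\<^sup>2 \<le> w \<bullet> (M *v w)" by blast
  have l: "l \<in> eigenvalues M" using u by (auto simp: eigenvalues_def eigenspace_def)
  then show "lambda_min M \<in> eigenvalues M"
    unfolding lambda_min_def using Min_in[OF finite_eigenvalues[OF M]] by blast
  have "lambda_min M \<le> l"
    unfolding lambda_min_def using Min_le[OF finite_eigenvalues[OF M]] l by blast
  then have "lambda_min M * (norm w)\<^sup>2 \<le> l * (norm w)\<^sup>2" by (intro mult_right_mono) auto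
  with low show "lambda_min M * (norm w)\<^sup>2 \<le> w \<bullet> (M *v w)" by (meson order_trans)
qed

lemma lambda_min_bounds:
  assumes D: "symmetric_mat D" "0 \<prec>\<^sub>L D" "D \<preceq>\<^sub>L mat 1"
  shows "0 < lambda_min D" "lambda_min D \<le> 1"
proof -
  from lambda_min_rayleigh(1)[OF D(1)] obtain v
    where v: "v \<noteq> 0" "D *v v = lambda_min D *\<^sub>R v"
    by (auto simp: eigenvalues_def eigenspace_def)
  have "0 < v \<bullet> (D *v v)" using D(2) v(1) by (simp add: loewner_less_def pd_def)
  then show "0 < lambda_min D" using v inner_ge_zero[of v] by (auto simp: zero_less_mult_iff)
  have "0 \<le> v \<bullet> ((mat 1 - D) *v v)" using D(3) by (simp add: loewner_le_def psd_def)
  then have "0 \<le> (1 - lambda_min D) * (v \<bullet> v)"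
    using v by (simp add: algebra_simps)
  then show "lambda_min D \<le> 1" using v by (simp add: zero_le_mult_iff)
qed

lemma lambda_min_mat_1 [simp]: "lambda_min (mat 1 :: real^'n^'n) = 1"
proof -
  have "eigenvalues (mat 1 :: real^'n^'n) = {1}"
  proof (intro equalityI subsetI)
    fix l assume "l \<in> eigenvalues (mat 1 :: real^'n^'n)"
    then obtain v :: "real^'n" where "v \<noteq> 0" "1 *\<^sub>R v = l *\<^sub>R v"
      by (auto simp: eigenvalues_def eigenspace_def)
    then show "l \<in> {1}" by (metis scaleR_cancel_right singleton_iff)
  qed (auto simp: eigenvalues_def eigenspace_def intro!: exI[of _ 1])
  then show ?thesis by (simp add: lambda_min_def)
qed

text \<open>The kernel is one-dimensional, so the eigenvalue list starts with exactly one 0 and its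
  entry at index 1 is the smallest nonzero eigenvalue.\<close>

lemma lambda_2_le:
  assumes C: "psd C" and null: "dim (null_space C) = 1" and c: "c \<in> eigenvalues C" "c \<noteq> 0"
  shows "lambda_2 C \<le> c"
proof -
  have sym: "symmetric_mat C" using C by (simp add: psd_def)
  let ?E = "eigenvalues C"
  have fin: "finite ?E" by (rule finite_eigenvalues[OF sym])
  have nn: "0 \<le> l" if "l \<in> ?E" for l
  proof -
    from that obtain v where v: "v \<noteq> 0" "C *v v = l *\<^sub>R v"
      by (auto simp: eigenvalues_def eigenspace_def)
    have "0 \<le> v \<bullet> (C *v v)" using C by (simp add: psd_def)
    then show ?thesis using v by (simp add: zero_le_mult_iff)
  qed
  have E0: "eigenspace C 0 = null_space C" by (simp add: eigenspace_def null_space_def)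
  have dim_pos: "0 < dim (eigenspace C l)" if "l \<in> ?E" for l
    using that by (auto simp: eigenvalues_def dim_eq_0 intro!: gr0I)
  have z: "0 \<in> ?E"
  proof -
    have "\<not> null_space C \<subseteq> {0}" using null dim_eq_0[of "null_space C"] by simp
    then show ?thesis by (auto simp: eigenvalues_def E0)
  qed
  have "Min ?E = 0" using nn z fin by (intro Min_eqI) auto
  then have l1: "sorted_list_of_set ?E = 0 # sorted_list_of_set (?E - {0})"
    using sorted_list_of_set_nonempty[OF fin] z by auto
  have ne: "?E - {0} \<noteq> {}" using c by auto
  define m where "m = Min (?E - {0})"
  have m: "m \<in> ?E - {0}" "m \<le> c"
    unfolding m_def using Min_in[OF _ ne] Min_le[of "?E - {0}" c] fin c by auto
  have l2: "sorted_list_of_set (?E - {0}) = m # sorted_list_of_set (?E - {0} - {m})"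
    using sorted_list_of_set_nonempty[OF _ ne] fin m_def by auto
  \<comment> \<open>A positive dimension makes the block of copies of \<open>m\<close> nonempty, so
    index 1 really falls on \<open>m\<close>.\<close>
  obtain n where "dim (eigenspace C m) = Suc n" using dim_pos[of m] m gr0_conv_Suc by auto
  then have "lambda_2 C = m"
    using null by (simp add: lambda_2_def eigenvalue_list_def l1 l2 E0)
  with m show ?thesis by simp
qed

section \<open>Smooth and strongly convex functions\<close>

lemma GDERIV_gradient:
  fixes f :: "'a::euclidean_space \<Rightarrow> real"
  assumes "f differentiable (at x)"
  shows "GDERIV f x :> gradient f x"
proof -
  from assms obtain f' where f': "(f has_derivative f') (at x)" by (auto simp: differentiable_def)
  interpret linear f' using f' by (rule has_derivative_linear)
  define D where "D = (\<Sum>b\<in>Basis. f' b *\<^sub>R b)"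
  have f'_eq: "f' = (\<lambda>h. h \<bullet> D)"
  proof
    fix h
    have "f' h = f' (\<Sum>b\<in>Basis. (h \<bullet> b) *\<^sub>R b)" by (simp add: euclidean_representation)
    also have "\<dots> = h \<bullet> D" by (simp add: sum scaleR D_def inner_sum_right mult.commute)
    finally show "f' h = h \<bullet> D" .
  qed
  have D: "GDERIV f x :> D" using f' unfolding gderiv_def f'_eq .
  have "E = D" if "GDERIV f x :> E" for E
  proof -
    have "(\<lambda>h. h \<bullet> E) = (\<lambda>h. h \<bullet> D)"
      using that D unfolding gderiv_def by (rule has_derivative_unique)
    then show ?thesis by (metis vector_eq_ldot)
  qed
  with D show ?thesis unfolding gradient_def by (rule theI)
qed

text \<open>The sign \<open>s\<close> yields the upper and the lower bound in one proof. Along the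
  segment from \<open>x\<close> to \<open>y\<close>, the difference of the two sides is
  nonincreasing, by Cauchy-Schwarz and the Lipschitz gradient.\<close>

lemma L_smooth_bregman:
  fixes f :: "'a::euclidean_space \<Rightarrow> real"
  assumes f: "L_smooth L f" and s: "\<bar>s\<bar> = 1"
  shows "s * (f y - f x - gradient f x \<bullet> (y - x)) \<le> L / 2 * (norm (y - x))\<^sup>2"
proof -
  define v where "v = y - x"
  define g where "g = gradient f x"
  let ?\<phi> = "\<lambda>t. s * (f (x + t *\<^sub>R v) - t * (g \<bullet> v)) - L / 2 * (norm v)\<^sup>2 * t\<^sup>2"
  have "?\<phi> 1 \<le> ?\<phi> 0"
  proof (rule DERIV_nonpos_imp_nonincreasing[where f = ?\<phi>])
    fix t :: real assume t: "0 \<le> t" "t \<le> 1"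
    let ?e = "gradient f (x + t *\<^sub>R v) - g"
    have "(f has_derivative (\<lambda>h. h \<bullet> gradient f (x + t *\<^sub>R v))) (at (x + t *\<^sub>R v))"
      using GDERIV_gradient f by (auto simp: L_smooth_def gderiv_def)
    moreover have "((\<lambda>t. x + t *\<^sub>R v) has_derivative (\<lambda>h. h *\<^sub>R v)) (at t)"
      by (auto intro!: derivative_eq_intros)
    ultimately have "((\<lambda>t. f (x + t *\<^sub>R v)) has_derivative (\<lambda>h. (h *\<^sub>R v) \<bullet> gradient f (x + t *\<^sub>R v))) (at t)"
      by (rule has_derivative_compose[rotated])
    then have "((\<lambda>t. f (x + t *\<^sub>R v)) has_real_derivative (v \<bullet> gradient f (x + t *\<^sub>R v))) (at t)"
      by (rule has_derivative_imp_has_field_derivative) simp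
    then have "(?\<phi> has_real_derivative (s * (?e \<bullet> v) - L * (norm v)\<^sup>2 * t)) (at t)"
      by (auto intro!: derivative_eq_intros simp: inner_diff_left inner_diff_right inner_commute)
    moreover have "s * (?e \<bullet> v) \<le> L * (norm v)\<^sup>2 * t"
    proof -
      have "s * (?e \<bullet> v) \<le> \<bar>s * (?e \<bullet> v)\<bar>" by (rule abs_ge_self)
      also have "\<dots> = \<bar>?e \<bullet> v\<bar>" using s by (simp add: abs_mult)
      also have "\<dots> \<le> norm ?e * norm v" by (rule Cauchy_Schwarz_ineq2)
      also have "norm ?e \<le> L * norm (t *\<^sub>R v)"
        using f unfolding L_smooth_def g_def
        by (metis add_diff_cancel_left' dist_norm iso_tuple_UNIV_I lipschitz_onD)
      then have "norm ?e * norm v \<le> L * norm (t *\<^sub>R v) * norm v" by (rule mult_right_mono) simp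
      also have "\<dots> = L * (norm v)\<^sup>2 * t" using t by (simp add: power2_eq_square)
      finally show ?thesis .
    qed
    ultimately show "\<exists>d. (?\<phi> has_real_derivative d) (at t) \<and> d \<le> 0"
      by (intro exI[of _ "s * (?e \<bullet> v) - L * (norm v)\<^sup>2 * t"]) simp
  qed simp
  then show ?thesis by (simp add: v_def g_def algebra_simps)
qed

text \<open>At \<open>x + t (y - x)\<close>, strong convexity bounds \<open>f\<close> from above,
  while smoothness bounds it from below by the tangent up to order \<open>t^2\<close>. Comparing the
  two, dividing by \<open>t\<close> and letting \<open>t\<close> tend to 0 leaves the claim.\<close>

lemma strongly_convex_bregman:
  fixes f :: "'a::euclidean_space \<Rightarrow> real"
  assumes sc: "strongly_convex \<mu> f" and f: "L_smooth L f"
  shows "\<mu> / 2 * (norm (y - x))\<^sup>2 \<le> f y - f x - gradient f x \<bullet> (y - x)"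
proof -
  define n where "n = (norm (y - x))\<^sup>2"
  define g where "g = gradient f x \<bullet> (y - x)"
  define b where "b = f y - f x - g"
  have "\<mu> / 2 * n - b \<le> t * (\<mu> / 2 * n + L / 2 * n)" if t: "0 < t" "t < 1" for t
  proof -
    let ?p = "x + t *\<^sub>R (y - x)"
    have p: "?p = t *\<^sub>R y + (1 - t) *\<^sub>R x" by (simp add: algebra_simps)
    have "- (f ?p - f x - t * g) \<le> L / 2 * t * t * n"
      using L_smooth_bregman[OF f, of "-1" ?p x] t
      by (simp add: n_def g_def power_mult_distrib power2_eq_square mult_ac)
    moreover have "f ?p \<le> t * f y + (1 - t) * f x - \<mu> / 2 * t * (1 - t) * n"
      using sc t unfolding strongly_convex_def p n_def by auto
    moreover have "t * (\<mu> / 2 * n - b) - t * (t * (\<mu> / 2 * n + L / 2 * n))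
        = (f x + t * g - L / 2 * t * t * n) - (t * f y + (1 - t) * f x - \<mu> / 2 * t * (1 - t) * n)"
      by (simp add: b_def field_simps)
    ultimately have "t * (\<mu> / 2 * n - b) \<le> t * (t * (\<mu> / 2 * n + L / 2 * n))" by linarith
    then show ?thesis using t by simp
  qed
  from le_zero_if_le_small_mult[OF this] show ?thesis by (simp add: n_def b_def g_def)
qed

text \<open>The Baillon-Haddad argument. The map \<open>p\<close> plays the gradient of
  \<open>\<phi>\<close>, but enters only through the two Bregman inequalities.\<close>

lemma cocoercive_if_bregman:
  fixes \<phi> :: "'a::real_inner \<Rightarrow> real"
  assumes M: "0 < M"
    and lo: "\<And>x y. 0 \<le> \<phi> y - \<phi> x - p x \<bullet> (y - x)"
    and up: "\<And>x y. \<phi> y - \<phi> x - p x \<bullet> (y - x) \<le> M / 2 * (norm (y - x))\<^sup>2"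
  shows "(norm (p y - p x))\<^sup>2 \<le> M * ((p y - p x) \<bullet> (y - x))"
proof -
  have half: "(p y - p x) \<bullet> (p y - p x) / (2 * M) \<le> \<phi> y - \<phi> x - p x \<bullet> (y - x)" for x y
  proof -
    define e where "e = p y - p x"
    \<comment> \<open>A gradient step of length \<open>1 / M\<close> from \<open>y\<close> for the
      tilted function \<open>\<phi> - p x \<bullet> _\<close>; it minimises the quadratic upper
      model at \<open>y\<close>.\<close>
    define z where "z = y - (1 / M) *\<^sub>R e"
    have "p x \<bullet> (z - x) \<le> \<phi> z - \<phi> x" using lo[of z x] by simp
    moreover have "\<phi> z \<le> \<phi> y + p y \<bullet> (z - y) + M / 2 * (norm (z - y))\<^sup>2"
      using up[of z y] by simp
    moreover have "M / 2 * (norm (z - y))\<^sup>2 = e \<bullet> e / (2 * M)"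
      using M by (simp add: z_def power_mult_distrib power2_norm_eq_inner[symmetric] power_divide)
        (simp add: field_simps power2_eq_square)
    moreover have "p y \<bullet> (z - y) - p x \<bullet> (z - x) = - (e \<bullet> e) / M - p x \<bullet> (y - x)"
    proof -
      have "z - y = - ((1 / M) *\<^sub>R e)" "z - x = (y - x) - (1 / M) *\<^sub>R e"
        by (simp_all add: z_def)
      moreover have "e \<bullet> e = p y \<bullet> e - p x \<bullet> e" by (metis e_def inner_diff_left)
      ultimately show ?thesis by (simp add: inner_diff_right diff_divide_distrib)
    qed
    moreover have "(e \<bullet> e) / M = e \<bullet> e / (2 * M) + e \<bullet> e / (2 * M)"
      by simp
    ultimately show ?thesis unfolding e_def[symmetric] by linarith
  qed
  \<comment> \<open>Adding \<open>half\<close> to its copy with \<open>x\<close> and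
    \<open>y\<close> exchanged cancels the values of \<open>\<phi>\<close>.\<close>
  have "(p y - p x) \<bullet> (p y - p x) / M \<le> (p y - p x) \<bullet> (y - x)"
  proof -
    have "(p x - p y) \<bullet> (p x - p y) = (p y - p x) \<bullet> (p y - p x)"
      by (metis inner_minus_left inner_minus_right minus_diff_eq minus_minus)
    moreover have "p y \<bullet> (x - y) = - (p y \<bullet> (y - x))" by (simp add: inner_diff_right)
    moreover have "(p y - p x) \<bullet> (y - x) = p y \<bullet> (y - x) - p x \<bullet> (y - x)"
      by (rule inner_diff_left)
    moreover have "c / M = c / (2 * M) + c / (2 * M)" for c by simp
    ultimately show ?thesis
      using half[of y x] half[of x y] by smt
  qed
  then show ?thesis using M by (simp add: power2_norm_eq_inner field_simps)
qed

text \<open>Adding \<open>d / 2\<close> times the squared norm turns the two-sided bound into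
  convexity and smoothness with modulus \<open>2 d\<close>. Cocoercivity of the shifted map
  \<open>p + d id\<close> then expands to the Lipschitz bound, as the mixed terms cancel.\<close>

lemma lipschitz_if_bregman:
  fixes h :: "'a::real_inner \<Rightarrow> real"
  assumes c: "0 \<le> c"
    and br: "\<And>x y. \<bar>h y - h x - p x \<bullet> (y - x)\<bar> \<le> c / 2 * (norm (y - x))\<^sup>2"
  shows "norm (p y - p x) \<le> c * norm (y - x)"
proof -
  \<comment> \<open>Cocoercivity asks for a positive modulus, whereas \<open>c\<close> may be 0;
    hence the detour through every \<open>d > c\<close>.\<close>
  have pos: "norm (p y - p x) \<le> d * norm (y - x)" if d: "c < d" for d
  proof -
    have d0: "0 < d" using c d by simp
    have br': "\<bar>h y - h x - p x \<bullet> (y - x)\<bar> \<le> d / 2 * (norm (y - x))\<^sup>2" for x y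
      using br[of y x] d by (smt (verit) divide_right_mono mult_right_mono zero_le_power2)
    define \<phi> where "\<phi> x = h x + d / 2 * (norm x)\<^sup>2" for x
    define q where "q x = p x + d *\<^sub>R x" for x
    have eq: "\<phi> y - \<phi> x - q x \<bullet> (y - x)
        = (h y - h x - p x \<bullet> (y - x)) + d / 2 * (norm (y - x))\<^sup>2" for x y
      by (simp add: \<phi>_def q_def power2_norm_eq_inner algebra_simps inner_diff_left
          inner_diff_right inner_add_left inner_commute)
    have "(norm (q y - q x))\<^sup>2 \<le> (2 * d) * ((q y - q x) \<bullet> (y - x))"
    proof (rule cocoercive_if_bregman)
      show "0 \<le> \<phi> y - \<phi> x - q x \<bullet> (y - x)" for x y
        unfolding eq using br'[of y x] by linarith
      show "\<phi> y - \<phi> x - q x \<bullet> (y - x) \<le> 2 * d / 2 * (norm (y - x))\<^sup>2" for x y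
        unfolding eq using abs_le_D1[OF br'[of y x]] by simp
    qed (use d0 in simp)
    moreover define e where "e = p y - p x"
    moreover define v where "v = y - x"
    moreover have "q y - q x = e + d *\<^sub>R v" by (simp add: q_def e_def v_def algebra_simps)
    ultimately have "(norm (e + d *\<^sub>R v))\<^sup>2 \<le> 2 * d * ((e + d *\<^sub>R v) \<bullet> v)" by simp
    then have "(norm e)\<^sup>2 \<le> d\<^sup>2 * (norm v)\<^sup>2"
      unfolding power2_norm_eq_inner
      by (simp add: inner_add_left inner_add_right inner_commute power2_eq_square algebra_simps)
    then have "(norm (p y - p x))\<^sup>2 \<le> d\<^sup>2 * (norm (y - x))\<^sup>2" by (simp add: e_def v_def)
    then have "(norm (p y - p x))\<^sup>2 \<le> (d * norm (y - x))\<^sup>2" by (simp add: power_mult_distrib)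
    then show ?thesis using d0 by (meson less_imp_le mult_nonneg_nonneg norm_ge_zero power2_le_imp_le)
  qed
  have "norm (p y - p x) - c * norm (y - x) \<le> t * norm (y - x)" if "0 < t" "t < 1" for t
    using pos[of "c + t"] that by (simp add: algebra_simps)
  from le_zero_if_le_small_mult[OF this] show ?thesis by simp
qed

section \<open>Proximal maps of separable sums\<close>

lemma convex_funD:
  assumes G: "convex_fun G" and xy: "G x = ereal a" "G y = ereal b" and t: "0 \<le> t" "t \<le> 1"
  shows "G (x + t *\<^sub>R (y - x)) \<le> ereal (a + t * (b - a))"
proof -
  have "(1 - t) *\<^sub>R (x, a) + t *\<^sub>R (y, b) \<in> epigraph_ext G"
    using G xy t unfolding convex_fun_def
    by (intro convexD) (auto simp: epigraph_ext_def)
  then show ?thesis by (simp add: epigraph_ext_def algebra_simps)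
qed

text \<open>Fermat's rule for \<open>\<phi> + G\<close>: \<open>-p\<close> is a subgradient of
  \<open>G\<close> at the minimiser. Only a quadratic upper model of \<open>\<phi>\<close> is
  assumed, which fits both the average of the \<open>f i\<close> and the quadratic term of the
  proximal map. The proof moves from \<open>x\<close> towards \<open>y\<close> by \<open>t\<close>
  and uses convexity of \<open>G\<close>.\<close>

lemma arg_min_subgradient:
  fixes \<phi> :: "'a::real_inner \<Rightarrow> real"
  assumes proper: "proper_fun G" and conv: "convex_fun G"
    and min: "\<And>y. ereal (\<phi> x) + G x \<le> ereal (\<phi> y) + G y"
    and up: "\<And>y. \<phi> y \<le> \<phi> x + p \<bullet> (y - x) + K * (norm (y - x))\<^sup>2"
  obtains a where "G x = ereal a" "\<And>y b. G y = ereal b \<Longrightarrow> a \<le> b + p \<bullet> (y - x)"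
proof -
  from proper obtain w where w: "G w < \<infinity>" and nm: "\<And>y. G y \<noteq> -\<infinity>" by (auto simp: proper_fun_def)
  have "ereal (\<phi> x) + G x < \<infinity>" using min[of w] w by (cases "G w") auto
  with nm[of x] obtain a where a: "G x = ereal a" by (cases "G x") auto
  have "a \<le> b + p \<bullet> (y - x)" if b: "G y = ereal b" for y b
  proof -
    have "a - b - p \<bullet> (y - x) \<le> t * (K * (norm (y - x))\<^sup>2)" if t: "0 < t" "t < 1" for t
    proof -
      let ?z = "x + t *\<^sub>R (y - x)"
      have "ereal (\<phi> x) + G x \<le> ereal (\<phi> ?z) + G ?z" by (rule min)
      also have "\<dots> \<le> ereal (\<phi> ?z) + ereal (a + t * (b - a))"
        using convex_funD[OF conv a b, of t] t by (intro add_left_mono) auto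
      finally have "\<phi> x + a \<le> \<phi> ?z + (a + t * (b - a))" by (simp add: a)
      moreover have "\<phi> ?z \<le> \<phi> x + t * (p \<bullet> (y - x)) + t * (t * (K * (norm (y - x))\<^sup>2))"
        using up[of ?z] by (simp add: power_mult_distrib power2_eq_square mult_ac)
      ultimately have "t * (a - b - p \<bullet> (y - x)) \<le> t * (t * (K * (norm (y - x))\<^sup>2))"
        by (simp add: algebra_simps)
      then show ?thesis using t by simp
    qed
    from le_zero_if_le_small_mult[OF this] show ?thesis by simp
  qed
  with a that show ?thesis by blast
qed

text \<open>A known subgradient \<open>s\<close> of \<open>G\<close> at \<open>x\<close> gives an
  affine minorant, which makes the proximal objective coercive. Minimising over the closed epigraph
  replaces lower semicontinuity of \<open>G\<close> by continuity of \<open>?h\<close>.\<close>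

lemma prox_exists:
  fixes G :: "'a::euclidean_space \<Rightarrow> ereal"
  assumes proper: "proper_fun G" and closed: "closed_fun G" and \<gamma>: "0 < \<gamma>"
    and a: "G x = ereal a" and sub: "\<And>y b. G y = ereal b \<Longrightarrow> a + s \<bullet> (y - x) \<le> b"
  obtains u where "\<And>y. G u + ereal (1 / (2 * \<gamma>) * (norm (z - u))\<^sup>2)
      \<le> G y + ereal (1 / (2 * \<gamma>) * (norm (z - y))\<^sup>2)"
proof -
  let ?h = "\<lambda>w. snd w + 1 / (2 * \<gamma>) * (norm (z - fst w))\<^sup>2"
  define r0 where "r0 = a + 1 / (2 * \<gamma>) * (norm (z - x))\<^sup>2"
  define K where "K = epigraph_ext G \<inter> {w. ?h w \<le> r0}"
  have nm: "G y \<noteq> -\<infinity>" for y using proper by (simp add: proper_fun_def)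
  have cont: "continuous_on UNIV ?h" by (intro continuous_intros)
  have sub': "a + s \<bullet> (y - x) \<le> r" if "(y, r) \<in> epigraph_ext G" for y r
    using that nm[of y] sub[of y] by (cases "G y") (force simp: epigraph_ext_def)+
  \<comment> \<open>For \<open>n = norm (z - y) > 1\<close>, membership in \<open>K\<close> gives
    \<open>n^2 / (2 \<gamma>) \<le> (\<bar>r0 - a + s \<bullet> (x - z)\<bar> + norm s) n\<close>;
    the summand 1 covers \<open>n \<le> 1\<close>.\<close>
  define R where "R = 2 * \<gamma> * (\<bar>r0 - a + s \<bullet> (x - z)\<bar> + norm s) + 1"
  have R: "norm (z - y) \<le> R" if "(y, r) \<in> K" for y r
  proof (cases "norm (z - y) \<le> 1")
    case True
    moreover have "1 \<le> R" using \<gamma> by (simp add: R_def)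
    ultimately show ?thesis by simp
  next
    case False
    define n where "n = norm (z - y)"
    have "1 / (2 * \<gamma>) * n\<^sup>2 \<le> r0 - r" using that by (auto simp: K_def n_def)
    also have "\<dots> \<le> r0 - a - s \<bullet> (y - x)" using sub'[of y r] that by (simp add: K_def)
    also have "\<dots> = (r0 - a + s \<bullet> (x - z)) + s \<bullet> (z - y)" by (simp add: inner_diff_right)
    also have "\<dots> \<le> \<bar>r0 - a + s \<bullet> (x - z)\<bar> + norm s * n"
      using norm_cauchy_schwarz[of s "z - y"] by (simp add: n_def)
    also have "\<dots> \<le> \<bar>r0 - a + s \<bullet> (x - z)\<bar> * n + norm s * n"
      using False by (simp add: n_def mult_le_cancel_left1)
    finally have "n * n \<le> (2 * \<gamma> * (\<bar>r0 - a + s \<bullet> (x - z)\<bar> + norm s)) * n"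
      using \<gamma> by (simp add: field_simps power2_eq_square)
    then have "n \<le> 2 * \<gamma> * (\<bar>r0 - a + s \<bullet> (x - z)\<bar> + norm s)"
      using False by (auto simp: n_def mult_le_cancel_right)
    then show ?thesis by (simp add: R_def n_def)
  qed
  have "K \<subseteq> cball z R \<times> {a - norm s * (R + norm (z - x)) .. r0}"
  proof (rule subrelI)
    fix y r assume yr: "(y, r) \<in> K"
    from R[OF yr] have 1: "norm (z - y) \<le> R" .
    have "r \<le> r0" using yr \<gamma> by (auto simp: K_def intro: order_trans[rotated])
    moreover have "a - norm s * (R + norm (z - x)) \<le> r"
    proof -
      have "- (s \<bullet> (y - x)) \<le> norm s * norm (y - x)"
        using Cauchy_Schwarz_ineq2[of s "y - x"] by linarith
      also have "\<dots> \<le> norm s * (R + norm (z - x))"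
        using 1 norm_triangle_ineq4[of "z - x" "z - y"] by (intro mult_left_mono) auto
      finally show ?thesis using sub'[of y r] yr by (simp add: K_def)
    qed
    ultimately show "(y, r) \<in> cball z R \<times> {a - norm s * (R + norm (z - x)) .. r0}"
      using 1 by (simp add: dist_norm)
  qed
  then have bdd: "bounded K" by (rule bounded_subset[rotated]) (simp add: bounded_Times)
  have "closed {w. ?h w \<le> r0}" using cont by (intro closed_Collect_le continuous_on_const)
  then have "compact K"
    using closed bdd unfolding K_def closed_fun_def by (simp add: compact_eq_bounded_closed closed_Int)
  moreover have x: "(x, a) \<in> K" by (simp add: K_def epigraph_ext_def a r0_def)
  ultimately obtain w where w: "w \<in> K" "\<And>v. v \<in> K \<Longrightarrow> ?h w \<le> ?h v"
    using continuous_attains_inf[of K ?h] continuous_on_subset[OF cont] by blast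
  have "G (fst w) + ereal (1 / (2 * \<gamma>) * (norm (z - fst w))\<^sup>2)
      \<le> G y + ereal (1 / (2 * \<gamma>) * (norm (z - y))\<^sup>2)" for y
  proof (cases "G y")
    case (real b)
    have "?h w \<le> b + 1 / (2 * \<gamma>) * (norm (z - y))\<^sup>2"
    proof (cases "(y, b) \<in> K")
      case True from w(2)[OF this] show ?thesis by simp
    next
      case False
      then have "r0 < b + 1 / (2 * \<gamma>) * (norm (z - y))\<^sup>2"
        by (simp add: K_def epigraph_ext_def real)
      then show ?thesis using w(1) by (simp add: K_def)
    qed
    moreover have "G (fst w) \<le> ereal (snd w)" using w(1) by (auto simp: K_def epigraph_ext_def)
    ultimately show ?thesis using real by (cases "G (fst w)") auto
  qed (use nm in auto)
  then show ?thesis by (rule that)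
qed

text \<open>Changing row \<open>i\<close> alone leaves the remaining sum \<open>S\<close> fixed.
  Comparison with the matrix whose rows all equal \<open>w\<close> shows that \<open>S\<close> is
  finite, so it may be cancelled in \<open>ereal\<close>.\<close>

lemma sum_ereal_arg_min_row:
  fixes \<phi> :: "'m::finite \<Rightarrow> 'a \<Rightarrow> ereal"
  assumes min: "\<And>Y. (\<Sum>i\<in>UNIV. \<phi> i (X $ i)) \<le> (\<Sum>i\<in>UNIV. \<phi> i (Y $ i))"
    and fin: "\<And>i. \<phi> i w < \<infinity>" and nm: "\<And>i y. \<phi> i y \<noteq> -\<infinity>"
  shows "\<phi> i (X $ i) \<le> \<phi> i y"
proof -
  define S where "S = (\<Sum>j\<in>UNIV-{i}. \<phi> j (X $ j))"
  define Y where "Y = (\<chi> j. if j = i then y else X $ j)"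
  have "(\<Sum>i\<in>UNIV. \<phi> i (X $ i)) \<le> (\<Sum>i\<in>UNIV. \<phi> i w)"
    using min[of "\<chi> i. w"] by simp
  also have "\<dots> < \<infinity>" using fin by (simp add: sum_Pinfty less_top[symmetric] top_ereal_def)
  finally have "(\<Sum>i\<in>UNIV. \<phi> i (X $ i)) \<noteq> \<infinity>" by simp
  then have "\<phi> j (X $ j) \<noteq> \<infinity>" for j by (auto simp: sum_Pinfty)
  then have S: "\<bar>S\<bar> \<noteq> \<infinity>"
    using nm unfolding S_def by (subst sum_Inf) (auto simp: \<open>\<And>j. \<phi> j (X $ j) \<noteq> \<infinity>\<close>)
  have "\<phi> i (X $ i) + S \<le> (\<Sum>j\<in>UNIV. \<phi> j (Y $ j))"
    using min[of Y] unfolding S_def by (simp add: sum.remove[of UNIV i])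
  also have "\<dots> = \<phi> i y + S"
    unfolding S_def by (subst sum.remove[of UNIV i]) (auto simp: Y_def intro!: sum.cong arg_cong2[where f="(+)"])
  finally show ?thesis using S by (cases S; cases "\<phi> i (X $ i)"; cases "\<phi> i y") auto
qed

lemma norm_matrix_power2: "(norm X)\<^sup>2 = (\<Sum>i\<in>UNIV. (norm (X $ i))\<^sup>2)"
  for X :: "'a::real_normed_vector^'m"
  by (simp add: norm_vec_def L2_set_def sum_nonneg)

text \<open>\<open>prox\<close> is a choice operator, so it minimises only once a minimiser is known
  to exist. Minimisers of the single rows, stacked, provide one; every minimiser is then minimal row
  by row.\<close>

lemma prox_sep_sum_row:
  fixes G :: "real^'d \<Rightarrow> ereal" and Z :: "real^'d^'m"
  assumes proper: "proper_fun G" and closed: "closed_fun G" and \<gamma>: "0 < \<gamma>"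
    and a: "G x = ereal a" and sub: "\<And>y b. G y = ereal b \<Longrightarrow> a + s \<bullet> (y - x) \<le> b"
  shows "G (prox \<gamma> (sep_sum G) Z $ i) + ereal (1 / (2 * \<gamma>) * (norm (Z $ i - prox \<gamma> (sep_sum G) Z $ i))\<^sup>2)
      \<le> G y + ereal (1 / (2 * \<gamma>) * (norm (Z $ i - y))\<^sup>2)"
proof -
  define \<phi> where "\<phi> i y = G y + ereal (1 / (2 * \<gamma>) * (norm (Z $ i - y))\<^sup>2)" for i y
  have nm: "G y \<noteq> -\<infinity>" for y using proper by (simp add: proper_fun_def)
  have sep: "sep_sum G Y + ereal (1 / (2 * \<gamma>) * (norm (Z - Y))\<^sup>2) = (\<Sum>i\<in>UNIV. \<phi> i (Y $ i))" for Y
    by (simp add: sep_sum_def \<phi>_def sum.distrib norm_matrix_power2 sum_distrib_left)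
  have "\<exists>u. \<forall>y. \<phi> i u \<le> \<phi> i y" for i
    using prox_exists[OF proper closed \<gamma> a sub, of "Z $ i"] unfolding \<phi>_def by metis
  then obtain u where "\<And>i y. \<phi> i (u i) \<le> \<phi> i y" by metis
  then have "is_arg_min (\<lambda>Y. sep_sum G Y + ereal (1 / (2 * \<gamma>) * (norm (Z - Y))\<^sup>2)) (\<lambda>_. True) (\<chi> i. u i)"
    unfolding sep is_arg_min_linorder by (auto intro!: sum_mono)
  then have "is_arg_min (\<lambda>Y. sep_sum G Y + ereal (1 / (2 * \<gamma>) * (norm (Z - Y))\<^sup>2)) (\<lambda>_. True)
      (prox \<gamma> (sep_sum G) Z)"
    unfolding prox_def arg_min_def by (rule someI)
  then have "\<phi> i (prox \<gamma> (sep_sum G) Z $ i) \<le> \<phi> i y"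
    unfolding sep is_arg_min_linorder
    by (intro sum_ereal_arg_min_row[where w = x]) (use nm a in \<open>auto simp: \<phi>_def\<close>)
  then show ?thesis by (simp add: \<phi>_def)
qed

text \<open>Nonexpansiveness against one reference point: \<open>s\<close> is a subgradient at
  \<open>x\<close>, so \<open>x\<close> is the proximal point of
  \<open>x + \<gamma> s\<close>.\<close>

lemma prox_sep_sum_dist_le:
  fixes G :: "real^'d \<Rightarrow> ereal" and Z :: "real^'d^'m"
  assumes proper: "proper_fun G" and closed: "closed_fun G" and conv: "convex_fun G" and \<gamma>: "0 < \<gamma>"
    and a: "G x = ereal a" and sub: "\<And>y b. G y = ereal b \<Longrightarrow> a + s \<bullet> (y - x) \<le> b"
  shows "norm (prox \<gamma> (sep_sum G) Z - (\<chi> i. x)) \<le> norm (Z - (\<chi> i. x + \<gamma> *\<^sub>R s))"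
proof -
  have row: "norm (prox \<gamma> (sep_sum G) Z $ i - x) \<le> norm (Z $ i - (x + \<gamma> *\<^sub>R s))" for i
  proof -
    define u where "u = prox \<gamma> (sep_sum G) Z $ i"
    define z where "z = Z $ i"
    let ?\<phi> = "\<lambda>y. 1 / (2 * \<gamma>) * (norm (z - y))\<^sup>2"
    have min: "ereal (?\<phi> u) + G u \<le> ereal (?\<phi> y) + G y" for y
      using prox_sep_sum_row[OF proper closed \<gamma> a sub, of Z i y]
      by (simp add: u_def z_def add.commute)
    have exp: "(norm (z - y))\<^sup>2 = (norm (z - u))\<^sup>2 + 2 * ((u - z) \<bullet> (y - u)) + (norm (y - u))\<^sup>2" for y
      by (simp add: power2_norm_eq_inner algebra_simps inner_diff_left inner_diff_right inner_commute)
    have up: "?\<phi> y \<le> ?\<phi> u + ((1 / \<gamma>) *\<^sub>R (u - z)) \<bullet> (y - u) + 1 / (2 * \<gamma>) * (norm (y - u))\<^sup>2" for y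
      unfolding exp[of y] using \<gamma> by (simp add: add_divide_distrib)
    obtain b where b: "G u = ereal b"
      and "\<And>y c. G y = ereal c \<Longrightarrow> b \<le> c + ((1 / \<gamma>) *\<^sub>R (u - z)) \<bullet> (y - u)"
      using arg_min_subgradient[OF proper conv min up] by blast
    \<comment> \<open>Monotonicity of the subdifferential: adding the subgradient inequality at
      \<open>u\<close>, tested at \<open>x\<close>, to the one at \<open>x\<close>, tested at
      \<open>u\<close>, cancels \<open>a\<close> and \<open>b\<close>.\<close>
    from this(2)[OF a] sub[OF b] have "s \<bullet> (u - x) \<le> ((1 / \<gamma>) *\<^sub>R (u - z)) \<bullet> (x - u)"
      by linarith
    also have "\<dots> = ((u - z) \<bullet> (x - u)) / \<gamma>" by (simp only: inner_scaleR_left) simp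
    finally have "\<gamma> * (s \<bullet> (u - x)) \<le> (u - z) \<bullet> (x - u)" using \<gamma> by (simp add: field_simps)
    then have "(u - x) \<bullet> (u - x) \<le> (z - (x + \<gamma> *\<^sub>R s)) \<bullet> (u - x)"
      by (simp add: algebra_simps inner_diff_left inner_diff_right inner_add_left inner_commute)
    also have "\<dots> \<le> norm (z - (x + \<gamma> *\<^sub>R s)) * norm (u - x)" by (rule norm_cauchy_schwarz)
    finally have "norm (u - x) * norm (u - x) \<le> norm (z - (x + \<gamma> *\<^sub>R s)) * norm (u - x)"
      by (simp add: power2_norm_eq_inner[symmetric] power2_eq_square)
    then have "norm (u - x) \<le> norm (z - (x + \<gamma> *\<^sub>R s))"
      by (cases "u = x") (auto simp: mult_le_cancel_right)
    then show ?thesis by (simp add: u_def z_def)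
  qed
  have "(norm (prox \<gamma> (sep_sum G) Z - (\<chi> i. x)))\<^sup>2 \<le> (norm (Z - (\<chi> i. x + \<gamma> *\<^sub>R s)))\<^sup>2"
    unfolding norm_matrix_power2[where 'a = "real^'d"]
    by (intro sum_mono power_mono) (simp_all add: row)
  then show ?thesis by (rule power2_le_imp_le) simp
qed

section \<open>Symmetric matrices acting on stacked iterates\<close>

text \<open>Left multiplication acts on each column separately, so this splitting carries bounds on
  quadratic forms over from vectors to stacked iterates.\<close>

lemma inner_matrix_columns: "X \<bullet> Y = (\<Sum>j\<in>UNIV. column j X \<bullet> column j Y)"
  for X Y :: "real^'d^'m"
  by (simp add: inner_vec_def column_def) (rule sum.swap)

lemma column_matrix_mult: "column j (A ** X) = A *v column j X"
  by (simp add: column_def matrix_matrix_mult_def matrix_vector_mult_def vec_eq_iff)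

lemma symmetric_mat_inner_matrix:
  fixes X Y :: "real^'d^'m"
  shows "symmetric_mat M \<Longrightarrow> X \<bullet> (M ** Y) = (M ** X) \<bullet> Y"
  by (simp add: inner_matrix_columns column_matrix_mult symmetric_mat_inner)

lemma psd_inner_matrix:
  fixes X :: "real^'d^'m"
  shows "psd M \<Longrightarrow> 0 \<le> X \<bullet> (M ** X)"
  by (simp add: inner_matrix_columns column_matrix_mult psd_def sum_nonneg)

lemma lambda_min_inner_matrix:
  fixes X :: "real^'d^'m"
  assumes "symmetric_mat M"
  shows "lambda_min M * (norm X)\<^sup>2 \<le> X \<bullet> (M ** X)"
  using lambda_min_rayleigh(2)[OF assms]
  by (simp add: power2_norm_eq_inner inner_matrix_columns column_matrix_mult sum_distrib_left sum_mono)

section \<open>The gradient step\<close>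

lemma strong_convexity_le_smoothness:
  fixes f :: "'a::euclidean_space \<Rightarrow> real"
  assumes "strongly_convex \<mu> f" "L_smooth L f"
  shows "\<mu> \<le> L"
proof -
  obtain b :: 'a where "b \<in> Basis" using nonempty_Basis by blast
  then have "norm b = 1" by simp
  with strongly_convex_bregman[OF assms, of b 0] L_smooth_bregman[OF assms(2), of 1 b 0]
  show ?thesis by simp
qed

text \<open>Here \<open>l\<close> stands for \<open>lambda_min D\<close>. The first two bounds keep
  the curvature of the gradient step within \<open>1 - \<gamma> \<mu>\<close> in absolute value; the
  third compares the squared contraction factor with the radicand of \<open>q_factor\<close>; the
  fourth bounds that radicand below by its value at \<open>gamma_star\<close>.\<close>

lemma step_size_bounds:
  fixes \<mu> L l \<gamma> :: real
  assumes \<mu>: "0 < \<mu>" "\<mu> \<le> L" and l: "0 < l" "l \<le> 1" and \<gamma>: "0 < \<gamma>" "\<gamma> \<le> 2 * l / (L + \<mu> * l)"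
  shows "\<gamma> * (L + \<mu>) \<le> 1 + l" "\<gamma> * \<mu> \<le> 1"
    "(1 - \<gamma> * \<mu>)\<^sup>2 \<le> 1 - 2 * \<gamma> * L / (L / \<mu> + l)"
    "((L / \<mu> - l) / (L / \<mu> + l))\<^sup>2 \<le> 1 - 2 * \<gamma> * L / (L / \<mu> + l)"
proof -
  have L: "0 < L" using \<mu> by linarith
  have pos: "0 < L + \<mu> * l" using L \<mu> l by (simp add: add_pos_pos)
  have g: "\<gamma> * (L + \<mu> * l) \<le> 2 * l" using \<gamma>(2) pos by (simp add: field_simps)
  have kl: "L / \<mu> + l = (L + \<mu> * l) / \<mu>" using \<mu> by (simp add: field_simps)
  have ratio: "2 * \<gamma> * L / (L / \<mu> + l) = 2 * \<gamma> * L * \<mu> / (L + \<mu> * l)"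
    unfolding kl by simp
  have "\<mu> * l \<le> L" using \<mu> l L by (meson mult_left_le less_imp_le order_trans)
  \<comment> \<open>This product is \<open>(1 + l) (L + \<mu> l) - 2 l (L + \<mu>)\<close>.\<close>
  then have nn: "0 \<le> (1 - l) * (L - \<mu> * l)" using l by simp
  have "\<gamma> * (L + \<mu>) * (L + \<mu> * l) \<le> 2 * l * (L + \<mu>)"
    using mult_right_mono[OF g, of "L + \<mu>"] L \<mu> by (simp add: mult_ac)
  also have "\<dots> \<le> (1 + l) * (L + \<mu> * l)"
    using nn by (simp add: algebra_simps)
  finally show "\<gamma> * (L + \<mu>) \<le> 1 + l" by (rule mult_right_le_imp_le[OF _ pos])
  have "\<gamma> * \<mu> * (L + \<mu> * l) \<le> 2 * l * \<mu>"
    using mult_right_mono[OF g, of \<mu>] \<mu> by (simp add: mult_ac)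
  also have "\<dots> \<le> 1 * (L + \<mu> * l)"
    using \<open>\<mu> * l \<le> L\<close> by (simp add: algebra_simps)
  finally show "\<gamma> * \<mu> \<le> 1" by (rule mult_right_le_imp_le[OF _ pos])
  have "\<gamma> * \<mu> * (\<gamma> * \<mu> * (L + \<mu> * l)) \<le> \<gamma> * \<mu> * (2 * l * \<mu>)"
    using g \<mu> \<gamma> by (intro mult_left_mono) (auto simp: mult_ac)
  then have "2 * \<gamma> * L * \<mu> \<le> (1 - (1 - \<gamma> * \<mu>)\<^sup>2) * (L + \<mu> * l)"
    by (simp add: power2_eq_square algebra_simps)
  then have "2 * \<gamma> * L * \<mu> / (L + \<mu> * l) \<le> 1 - (1 - \<gamma> * \<mu>)\<^sup>2"
    by (simp only: pos_divide_le_eq[OF pos])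
  then show "(1 - \<gamma> * \<mu>)\<^sup>2 \<le> 1 - 2 * \<gamma> * L / (L / \<mu> + l)"
    unfolding ratio by linarith
  have "2 * \<gamma> * L * \<mu> / (L + \<mu> * l) \<le> 2 * L * \<mu> * (2 * l / (L + \<mu> * l)) / (L + \<mu> * l)"
    using mult_left_mono[OF \<gamma>(2), of "2 * L * \<mu>"] L \<mu> pos by (intro divide_right_mono) (auto simp: mult_ac)
  also have "\<dots> = 1 - ((L / \<mu> - l) / (L / \<mu> + l))\<^sup>2"
  proof -
    have "L / \<mu> - l = (L - \<mu> * l) / \<mu>" using \<mu> by (simp add: field_simps)
    then have "(L / \<mu> - l) / (L / \<mu> + l) = (L - \<mu> * l) / (L + \<mu> * l)"
      unfolding kl using \<mu> by simp
    then have "1 - ((L / \<mu> - l) / (L / \<mu> + l))\<^sup>2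
        = ((L + \<mu> * l)\<^sup>2 - (L - \<mu> * l)\<^sup>2) / (L + \<mu> * l)\<^sup>2"
      using pos by (simp only: diff_divide_distrib power_divide[symmetric] divide_self) simp
    also have "(L + \<mu> * l)\<^sup>2 - (L - \<mu> * l)\<^sup>2 = 4 * L * \<mu> * l"
      by (simp add: power2_eq_square algebra_simps)
    finally show ?thesis by (simp add: power2_eq_square)
  qed
  finally show "((L / \<mu> - l) / (L / \<mu> + l))\<^sup>2 \<le> 1 - 2 * \<gamma> * L / (L / \<mu> + l)"
    unfolding ratio by linarith
qed

text \<open>\<open>D X - \<gamma> \<nabla>f(X)\<close> is the gradient of \<open>\<langle>X, D X\<rangle> / 2 - \<gamma> f(X)\<close>, a function whose curvature
  lies in \<open>[\<lambda>\<^sub>m\<^sub>i\<^sub>n(D) - \<gamma> L, 1 - \<gamma> \<mu>]\<close>, a subinterval of \<open>[-(1 - \<gamma> \<mu>), 1 - \<gamma> \<mu>]\<close>.\<close>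

lemma gradient_step_lipschitz:
  fixes f :: "'m::finite \<Rightarrow> real^'d \<Rightarrow> real" and D :: "real^'m^'m"
  assumes sc: "\<And>i. strongly_convex \<mu> (f i)" and sm: "\<And>i. L_smooth L (f i)"
    and D: "symmetric_mat D" "D \<preceq>\<^sub>L mat 1"
    and \<gamma>: "0 < \<gamma>" "\<gamma> * \<mu> \<le> 1" "\<gamma> * (L + \<mu>) \<le> 1 + lambda_min D"
  shows "norm ((D ** Y - \<gamma> *\<^sub>R stacked_gradient f Y) - (D ** X - \<gamma> *\<^sub>R stacked_gradient f X))
    \<le> (1 - \<gamma> * \<mu>) * norm (Y - X)"
proof (rule lipschitz_if_bregman[where h = "\<lambda>X. (X \<bullet> (D ** X)) / 2 - \<gamma> * (\<Sum>i\<in>UNIV. f i (X $ i))"])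
  show "0 \<le> 1 - \<gamma> * \<mu>" using \<gamma> by simp
  fix X Y :: "real^'d^'m"
  define V where "V = Y - X"
  define b where "b i = f i (Y $ i) - f i (X $ i) - gradient (f i) (X $ i) \<bullet> (Y $ i - X $ i)" for i
  have b: "\<mu> / 2 * (norm (V $ i))\<^sup>2 \<le> b i" "b i \<le> L / 2 * (norm (V $ i))\<^sup>2" for i
    using strongly_convex_bregman[where y = "Y $ i" and x = "X $ i", OF sc sm]
      L_smooth_bregman[where s = 1 and y = "Y $ i" and x = "X $ i", OF sm] by (simp_all add: b_def V_def)
  have nV: "(norm V)\<^sup>2 = (\<Sum>i\<in>UNIV. (norm (V $ i))\<^sup>2)" by (rule norm_matrix_power2)
  have blo: "\<mu> / 2 * (norm V)\<^sup>2 \<le> sum b UNIV" and bup: "sum b UNIV \<le> L / 2 * (norm V)\<^sup>2"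
    unfolding nV sum_distrib_left by (intro sum_mono b)+
  have Y: "Y = X + V" by (simp add: V_def)
  \<comment> \<open>By symmetry of \<open>D\<close>, the Bregman distance of the quadratic part is
    half the quadratic form at \<open>V\<close>.\<close>
  have quad: "(Y \<bullet> (D ** Y)) / 2 - (X \<bullet> (D ** X)) / 2 - (D ** X) \<bullet> V = (V \<bullet> (D ** V)) / 2"
    using symmetric_mat_inner_matrix[OF D(1), of X V]
    unfolding Y by (simp add: matrix_add_ldistrib inner_add_left inner_add_right inner_commute field_simps)
  have "stacked_gradient f X \<bullet> V = (\<Sum>i\<in>UNIV. gradient (f i) (X $ i) \<bullet> (Y $ i - X $ i))"
    unfolding inner_vec_def[of "stacked_gradient f X" V] by (simp add: stacked_gradient_def V_def)
  then have sumb: "sum b UNIV = (\<Sum>i\<in>UNIV. f i (Y $ i)) - (\<Sum>i\<in>UNIV. f i (X $ i)) - stacked_gradient f X \<bullet> V"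
    by (simp add: b_def sum_subtractf)
  have eq: "(Y \<bullet> (D ** Y)) / 2 - \<gamma> * (\<Sum>i\<in>UNIV. f i (Y $ i))
      - ((X \<bullet> (D ** X)) / 2 - \<gamma> * (\<Sum>i\<in>UNIV. f i (X $ i)))
      - (D ** X - \<gamma> *\<^sub>R stacked_gradient f X) \<bullet> (Y - X) = (V \<bullet> (D ** V)) / 2 - \<gamma> * sum b UNIV"
    unfolding quad[symmetric] sumb V_def[symmetric] by (simp add: inner_diff_left algebra_simps)
  have "0 \<le> V \<bullet> ((mat 1 - D) ** V)"
    using D(2) by (intro psd_inner_matrix) (simp add: loewner_le_def)
  then have Dup: "V \<bullet> (D ** V) \<le> (norm V)\<^sup>2"
    by (simp add: matrix_sub_rdistrib inner_diff_right power2_norm_eq_inner)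
  have Dlo: "lambda_min D * (norm V)\<^sup>2 \<le> V \<bullet> (D ** V)" by (rule lambda_min_inner_matrix[OF D(1)])
  have "\<gamma> * (\<mu> / 2 * (norm V)\<^sup>2) \<le> \<gamma> * sum b UNIV" "\<gamma> * sum b UNIV \<le> \<gamma> * (L / 2 * (norm V)\<^sup>2)"
    using blo bup \<gamma>(1) by (auto intro: mult_left_mono)
  \<comment> \<open>This places the lower curvature \<open>lambda_min D - \<gamma> L\<close> above
    \<open>-(1 - \<gamma> \<mu>)\<close>.\<close>
  moreover have "\<gamma> * (L + \<mu>) * (norm V)\<^sup>2 \<le> (1 + lambda_min D) * (norm V)\<^sup>2"
    using \<gamma>(3) by (intro mult_right_mono) auto
  ultimately show "\<bar>(Y \<bullet> (D ** Y)) / 2 - \<gamma> * (\<Sum>i\<in>UNIV. f i (Y $ i))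
      - ((X \<bullet> (D ** X)) / 2 - \<gamma> * (\<Sum>i\<in>UNIV. f i (X $ i)))
      - (D ** X - \<gamma> *\<^sub>R stacked_gradient f X) \<bullet> (Y - X)\<bar> \<le> (1 - \<gamma> * \<mu>) / 2 * (norm (Y - X))\<^sup>2"
    unfolding eq unfolding V_def[symmetric] abs_le_iff using Dup Dlo by (simp add: algebra_simps)
qed

section \<open>The Lyapunov function\<close>

text \<open>Supplies the weight \<open>W\<close>, the inverse of \<open>mat 1 - C\<close>. A trivial
  kernel gives invertibility; symmetry, semidefiniteness and commutation pass to the
  inverse.\<close>

lemma pd_inverse:
  fixes N :: "real^'n^'n"
  assumes N: "pd N"
  obtains W where "N ** W = mat 1" "W ** N = mat 1" "psd W"
    "\<And>P. P ** N = N ** P \<Longrightarrow> P ** W = W ** P"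
proof -
  have sym: "symmetric_mat N" using N by (simp add: pd_def)
  have "v = 0" if "N *v v = 0" for v
    using N that by (metis inner_zero_right less_irrefl pd_def)
  then obtain W where W: "W ** N = mat 1" using matrix_left_invertible_ker[of N] by blast
  then have W': "N ** W = mat 1" by (simp add: matrix_left_right_inverse)
  have "transpose W ** N = mat 1"
    by (metis W' matrix_transpose_mul sym symmetric_mat_1 symmetric_mat_def)
  then have symW: "symmetric_mat W"
    unfolding symmetric_mat_def by (metis W' matrix_mul_assoc matrix_mul_lid matrix_mul_rid)
  have "0 \<le> v \<bullet> (W *v v)" for v
  proof -
    have "v = N *v (W *v v)" by (simp add: matrix_vector_mul_assoc W')
    then have "v \<bullet> (W *v v) = (W *v v) \<bullet> (N *v (W *v v))" by (metis inner_commute)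
    also have "\<dots> \<ge> 0" using N by (cases "W *v v = 0") (auto simp: pd_def less_imp_le)
    finally show ?thesis .
  qed
  then have "psd W" using symW by (simp add: psd_def)
  moreover have "P ** W = W ** P" if "P ** N = N ** P" for P
    by (metis W W' that matrix_mul_assoc matrix_mul_lid matrix_mul_rid)
  ultimately show ?thesis using that W W' by blast
qed

text \<open>In terms of \<open>w = W Z\<close> and \<open>u = W U\<close> every occurrence of \<open>W\<close> disappears, because
  \<open>Z = w - C w\<close> and \<open>U = u - C u\<close>.\<close>

lemma lyapunov_identity:
  fixes U Z :: "real^'d^'m"
  assumes C: "symmetric_mat C" and W: "(mat 1 - C) ** W = mat 1" "C ** W = W ** C"
  shows "(norm Z)\<^sup>2 + (U + Z) \<bullet> (C ** (W ** (U + Z)))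
    = (Z + C ** U) \<bullet> (W ** (Z + C ** U)) + U \<bullet> (C ** U)"
proof -
  have inv: "X = W ** X - C ** (W ** X)" for X :: "real^'d^'m"
  proof -
    have "X = ((mat 1 - C) ** W) ** X" by (simp add: W)
    also have "\<dots> = W ** X - C ** (W ** X)"
      unfolding matrix_mul_assoc[symmetric] by (simp add: matrix_sub_rdistrib)
    finally show ?thesis .
  qed
  define w u where "w = W ** Z" and "u = W ** U"
  have Z: "Z = w - C ** w" and U: "U = u - C ** u" unfolding w_def u_def by (rule inv)+
  have WCU: "W ** (C ** U) = C ** u" by (simp add: u_def matrix_mul_assoc W)
  have "Z \<bullet> w = Z \<bullet> Z + Z \<bullet> (C ** w)" by (subst (2) Z) (simp add: inner_diff_right)
  moreover have "(C ** U) \<bullet> w = U \<bullet> (C ** w)" by (simp add: symmetric_mat_inner_matrix[OF C])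
  moreover have "(C ** U) \<bullet> (C ** u) + U \<bullet> (C ** U) = U \<bullet> (C ** u)"
    by (subst (3) U) (simp add: symmetric_mat_inner_matrix[OF C] matrix_sub_ldistrib inner_diff_right)
  moreover have "W ** (U + Z) = u + w" "W ** (Z + C ** U) = w + C ** u"
    by (simp_all add: matrix_add_ldistrib u_def w_def WCU[unfolded u_def])
  ultimately show ?thesis
    by (simp add: power2_norm_eq_inner matrix_add_ldistrib inner_add_left inner_add_right)
qed

text \<open>On an eigenvector of \<open>C\<close> with eigenvalue \<open>c\<close> the matrix acts
  as \<open>c (c - lambda_2 C)\<close>, which vanishes for \<open>c = 0\<close> and is nonnegative
  otherwise.\<close>

lemma psd_spectral_gap:
  fixes C :: "real^'m^'m"
  assumes C: "psd C" and null: "dim (null_space C) = 1"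
  shows "psd (C ** C - lambda_2 C *\<^sub>R C)"
proof (rule psd_if_commutes[where P = C])
  have sym: "symmetric_mat C" using C by (simp add: psd_def)
  then show "symmetric_mat C" "symmetric_mat (C ** C - lambda_2 C *\<^sub>R C)"
    by (auto intro: symmetric_mat_diff symmetric_mat_mult symmetric_mat_scaleR)
  show "(C ** C - lambda_2 C *\<^sub>R C) ** C = C ** (C ** C - lambda_2 C *\<^sub>R C)"
    by (simp add: matrix_sub_ldistrib matrix_sub_rdistrib matrix_mul_assoc scalar_matrix_assoc matrix_scalar_ac)
  fix v l c assume v: "v \<noteq> 0" "(C ** C - lambda_2 C *\<^sub>R C) *v v = l *\<^sub>R v" "C *v v = c *\<^sub>R v"
  have "(C ** C - lambda_2 C *\<^sub>R C) *v v = (c * (c - lambda_2 C)) *\<^sub>R v"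
    by (simp add: matrix_vector_mult_diff_rdistrib v(3) matrix_vector_mult_scaleR algebra_simps
        flip: matrix_vector_mul_assoc scaleR_matrix_vector_assoc)
  then have l: "l = c * (c - lambda_2 C)" using v by (metis scaleR_cancel_right)
  have "0 \<le> v \<bullet> (C *v v)" using C by (simp add: psd_def)
  then have "0 \<le> c" using v by (simp add: zero_le_mult_iff)
  moreover have "lambda_2 C \<le> c" if "c \<noteq> 0"
    using lambda_2_le[OF C null _ that] v by (auto simp: eigenvalues_def eigenspace_def)
  ultimately show "0 \<le> l" unfolding l by (cases "c = 0") auto
qed

lemma lyapunov_step:
  fixes U Z T :: "real^'d^'m"
  assumes B: "symmetric_mat B" and C: "psd C" and null: "dim (null_space C) = 1"
    and W: "(mat 1 - C) ** W = mat 1" "W ** (mat 1 - C) = mat 1" "psd W"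
    and comm: "C ** W = W ** C" "B ** W = W ** B" "B ** C = C ** B"
    and BC: "B ** B \<preceq>\<^sub>L mat 1 - C" and Z: "Z = B ** T - C ** U"
  shows "(norm Z)\<^sup>2 + (U + Z) \<bullet> (C ** (W ** (U + Z)))
    \<le> (norm T)\<^sup>2 + (1 - lambda_2 C) * (U \<bullet> (C ** (W ** U)))"
proof -
  have symC: "symmetric_mat C" using C by (simp add: psd_def)
  have WC: "W ** C = W - mat 1"
    using W(2) by (simp add: matrix_sub_ldistrib algebra_simps)
  \<comment> \<open>Multiplying \<open>B ** B \<preceq>\<^sub>L mat 1 - C\<close> by the commuting
    \<open>W\<close> gives \<open>B ** W ** B \<preceq>\<^sub>L mat 1\<close>, which bounds the term
    in \<open>T\<close>.\<close>
  have "psd (W ** (mat 1 - C - B ** B))"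
  proof (rule psd_mult[OF W(3)])
    show "psd (mat 1 - C - B ** B)" using BC by (simp add: loewner_le_def)
    show "W ** (mat 1 - C - B ** B) = (mat 1 - C - B ** B) ** W"
      by (simp add: matrix_sub_ldistrib matrix_sub_rdistrib comm)
         (metis comm(2) matrix_mul_assoc)
  qed
  moreover have "W ** (mat 1 - C - B ** B) = mat 1 - B ** W ** B"
    by (simp add: matrix_sub_ldistrib WC matrix_mul_assoc comm)
  ultimately have "0 \<le> T \<bullet> ((mat 1 - B ** W ** B) ** T)" using psd_inner_matrix by metis
  then have T: "(B ** T) \<bullet> (W ** (B ** T)) \<le> (norm T)\<^sup>2"
    by (simp add: matrix_sub_rdistrib inner_diff_right power2_norm_eq_inner
        symmetric_mat_inner_matrix[OF B] flip: matrix_mul_assoc)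
  \<comment> \<open>Since \<open>W ** C = W - mat 1\<close>, this product is
    \<open>(1 - lambda_2 C) C W - C\<close>, the contraction of the dual term.\<close>
  have "psd (W ** (C ** C - lambda_2 C *\<^sub>R C))"
  proof (rule psd_mult[OF W(3) psd_spectral_gap[OF C null]])
    have "W ** (C ** C) = C ** C ** W" by (metis comm(1) matrix_mul_assoc)
    then show "W ** (C ** C - lambda_2 C *\<^sub>R C) = (C ** C - lambda_2 C *\<^sub>R C) ** W"
      by (simp add: matrix_sub_ldistrib matrix_sub_rdistrib scalar_matrix_assoc[symmetric]
          matrix_scalar_ac comm)
  qed
  moreover have "W ** (C ** C - lambda_2 C *\<^sub>R C) = (1 - lambda_2 C) *\<^sub>R (C ** W) - C"
    by (simp add: matrix_sub_ldistrib matrix_mul_assoc WC matrix_sub_rdistrib matrix_scalar_ac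
        scalar_matrix_assoc[symmetric] comm algebra_simps)
  ultimately have "0 \<le> U \<bullet> (((1 - lambda_2 C) *\<^sub>R (C ** W) - C) ** U)" using psd_inner_matrix by metis
  then have "U \<bullet> (C ** U) \<le> (1 - lambda_2 C) * (U \<bullet> (C ** (W ** U)))"
    by (simp add: matrix_sub_rdistrib inner_diff_right flip: matrix_mul_assoc scalar_matrix_assoc)
  moreover have "Z + C ** U = B ** T" by (simp add: Z)
  ultimately show ?thesis using lyapunov_identity[OF symC W(1) comm(1), of Z U] T by simp
qed

text \<open>The range of a symmetric matrix is the orthogonal complement of its kernel; this is
  applied to each column.\<close>

lemma range_symmetric_mat:
  fixes C :: "real^'m^'m" and Y :: "real^'d^'m"
  assumes C: "symmetric_mat C" and null: "null_space C = span {e}"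
    and Y: "\<And>j. e \<bullet> column j Y = 0"
  obtains U where "C ** U = Y"
proof -
  have "\<exists>u. C *v u = column j Y" for j
  proof -
    let ?R = "range (\<lambda>v. C *v v)"
    have sub: "subspace ?R" by (intro linear_subspace_image subspace_UNIV) auto
    have "w \<bullet> column j Y = 0" if w: "w \<in> ?R\<^sup>\<bottom>" for w
    proof -
      have "(C *v w) \<bullet> (C *v w) = w \<bullet> (C *v (C *v w))" by (simp add: symmetric_mat_inner[OF C])
      also have "\<dots> = 0" using w by (auto simp: orthogonal_comp_def orthogonal_def inner_commute)
      finally have "w \<in> span {e}" using null by (auto simp: null_space_def)
      then show ?thesis using Y[of j] by (auto simp: span_singleton)
    qed
    then have "column j Y \<in> ?R\<^sup>\<bottom>\<^sup>\<bottom>" by (auto simp: orthogonal_comp_def orthogonal_def)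
    then show ?thesis by (auto simp: orthogonal_comp_self[OF sub])
  qed
  then obtain u where u: "\<And>j. C *v u j = column j Y" by metis
  define U :: "real^'d^'m" where "U = (\<chi> i j. u j $ i)"
  have "column j (C ** U) = column j Y" for j
    by (simp add: column_matrix_mult u[symmetric]) (simp add: U_def column_def)
  then have "C ** U = Y" by (simp add: column_def vec_eq_iff)
  then show ?thesis by (rule that)
qed

section \<open>Rates\<close>

lemma rate_at_gamma_star:
  fixes D :: "real^'m^'m"
  assumes \<mu>: "0 < \<mu>" "\<mu> \<le> L" and D: "symmetric_mat D" "0 \<prec>\<^sub>L D" "D \<preceq>\<^sub>L mat 1"
  shows "rate \<mu> L C D (gamma_star \<mu> L D)
    = max (((L / \<mu> - lambda_min D) / (L / \<mu> + lambda_min D))\<^sup>2) (1 - lambda_2 C)"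
    and "0 < gamma_star \<mu> L D"
    and "0 < \<gamma> \<Longrightarrow> \<gamma> \<le> gamma_star \<mu> L D \<Longrightarrow> (q_factor \<mu> L D \<gamma>)\<^sup>2 = 1 - 2 * \<gamma> * L / (L / \<mu> + lambda_min D)"
    and "0 < \<gamma> \<Longrightarrow> \<gamma> \<le> gamma_star \<mu> L D \<Longrightarrow> rate \<mu> L C D (gamma_star \<mu> L D) \<le> rate \<mu> L C D \<gamma>"
proof -
  note l = lambda_min_bounds[OF D]
  have L: "0 < L" using \<mu> by linarith
  have pos: "0 < L + \<mu> * lambda_min D" using L \<mu> l by (simp add: add_pos_pos)
  have pos': "0 < L / \<mu> + lambda_min D" using L \<mu> l by (simp add: add_pos_pos)
  show gs: "0 < gamma_star \<mu> L D" using pos l by (simp add: gamma_star_def)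
  \<comment> \<open>Squaring undoes the root only for a nonnegative radicand, and the radicand
    dominates a square.\<close>
  show q: "(q_factor \<mu> L D \<gamma>)\<^sup>2 = 1 - 2 * \<gamma> * L / (L / \<mu> + lambda_min D)"
    if "0 < \<gamma>" "\<gamma> \<le> gamma_star \<mu> L D" for \<gamma>
    unfolding q_factor_def
    by (rule real_sqrt_pow2, rule order_trans[OF zero_le_power2])
       (rule step_size_bounds(4)[OF \<mu> l that[unfolded gamma_star_def]])
  have "(q_factor \<mu> L D (gamma_star \<mu> L D))\<^sup>2 = ((L / \<mu> - lambda_min D) / (L / \<mu> + lambda_min D))\<^sup>2"
  proof -
    define k where "k = L / \<mu>"
    define n where "n = lambda_min D"
    have kn: "k + n \<noteq> 0" using pos' by (simp add: k_def n_def)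
    have "gamma_star \<mu> L D * L = 2 * n * k / (k + n)"
      using \<mu> by (simp add: gamma_star_def k_def n_def field_simps)
    then have "2 * gamma_star \<mu> L D * L / (k + n) = 4 * n * k / (k + n)\<^sup>2"
      by (simp only: mult.assoc) (simp add: power2_eq_square)
    also have "4 * n * k = (k + n)\<^sup>2 - (k - n)\<^sup>2" by (simp add: power2_eq_square algebra_simps)
    finally have "(q_factor \<mu> L D (gamma_star \<mu> L D))\<^sup>2 = (k - n)\<^sup>2 / (k + n)\<^sup>2"
      using q[OF gs order_refl] kn by (simp add: k_def[symmetric] n_def[symmetric] diff_divide_distrib)
    then show ?thesis by (simp only: k_def n_def power_divide)
  qed
  then show rate: "rate \<mu> L C D (gamma_star \<mu> L D)
    = max (((L / \<mu> - lambda_min D) / (L / \<mu> + lambda_min D))\<^sup>2) (1 - lambda_2 C)"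
    by (simp add: rate_def)
  show "rate \<mu> L C D (gamma_star \<mu> L D) \<le> rate \<mu> L C D \<gamma>"
    if "0 < \<gamma>" "\<gamma> \<le> gamma_star \<mu> L D" for \<gamma>
    unfolding rate unfolding rate_def q[OF that]
    by (intro max.mono order_refl step_size_bounds(4)[OF \<mu> l that[unfolded gamma_star_def]])
qed

lemma ratio_square_antimono:
  fixes k l :: real
  assumes "0 < l" "l \<le> 1" "1 \<le> k"
  shows "((k - 1) / (k + 1))\<^sup>2 \<le> ((k - l) / (k + l))\<^sup>2"
proof (rule power_mono)
  have "(k - 1) * (k + l) \<le> (k - l) * (k + 1)"
    using mult_right_mono[of l 1 k] assms by (simp add: algebra_simps)
  then show "(k - 1) / (k + 1) \<le> (k - l) / (k + l)" using assms by (simp add: frac_le_eq divide_simps)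
qed (use assms in simp)

section \<open>Contraction of the Lyapunov function along the iteration\<close>

lemma linear_convergence:
  fixes f :: "'m::finite \<Rightarrow> real^'d \<Rightarrow> real"
    and G :: "real^'d \<Rightarrow> ereal"
    and B C D :: "real^'m^'m"
    and X Y Z :: "nat \<Rightarrow> real^'d^'m"
  assumes \<mu>: "0 < \<mu>"
    and sc: "\<And>i. strongly_convex \<mu> (f i)" and sm: "\<And>i. L_smooth L (f i)"
    and G: "proper_fun G" "closed_fun G" "convex_fun G"
    and opt: "is_arg_min (\<lambda>x. ereal (1 / real CARD('m) * (\<Sum>i\<in>UNIV. f i x)) + G x) (\<lambda>_. True) xstar"
    and B: "symmetric_mat B" "1 v* B = 1"
    and D: "symmetric_mat D" "0 \<prec>\<^sub>L D" "D \<preceq>\<^sub>L mat 1" "1 \<bullet> (D *v 1) = real CARD('m)"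
    and C: "0 \<preceq>\<^sub>L C" "C \<prec>\<^sub>L mat 1" "null_space C = span {1}"
    and BC: "B ** C = C ** B" "B ** B \<preceq>\<^sub>L mat 1 - C"
    and \<gamma>: "0 < \<gamma>" "\<gamma> \<le> gamma_star \<mu> L D"
    and Y0: "Y 0 = 0"
    and X: "\<And>k. X k = prox \<gamma> (sep_sum G) (Z k)"
    and Z: "\<And>k. Z (Suc k) = (B ** D) ** X k - \<gamma> *\<^sub>R (B ** stacked_gradient f (X k)) - Y k"
    and Y: "\<And>k. Y (Suc k) = Y k + C ** Z (Suc k)"
  obtains K where "\<And>k. (norm (X k - (\<chi> i. xstar)))\<^sup>2 \<le> K * rate \<mu> L C D \<gamma> ^ k"
proof -
  let ?m = "real CARD('m)"
  have m: "0 < ?m" by simp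
  have L: "\<mu> \<le> L" using strong_convexity_le_smoothness[OF sc sm] by blast
  define p where "p = (1 / ?m) *\<^sub>R (\<Sum>i\<in>UNIV. gradient (f i) xstar)"
  define \<phi> where "\<phi> x = 1 / ?m * (\<Sum>i\<in>UNIV. f i x)" for x
  have up: "\<phi> y \<le> \<phi> xstar + p \<bullet> (y - xstar) + L / 2 * (norm (y - xstar))\<^sup>2" for y
  proof -
    have "(\<Sum>i\<in>UNIV. f i y) \<le> (\<Sum>i\<in>(UNIV::'m set). f i xstar + gradient (f i) xstar \<bullet> (y - xstar)
        + L / 2 * (norm (y - xstar))\<^sup>2)"
    proof (rule sum_mono)
      fix i
      show "f i y \<le> f i xstar + gradient (f i) xstar \<bullet> (y - xstar) + L / 2 * (norm (y - xstar))\<^sup>2"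
        using L_smooth_bregman[OF sm[of i], of 1 y xstar] by simp
    qed
    also have "\<dots> = (\<Sum>i\<in>UNIV. f i xstar) + (\<Sum>i\<in>UNIV. gradient (f i) xstar) \<bullet> (y - xstar)
        + ?m * (L / 2 * (norm (y - xstar))\<^sup>2)"
      by (simp add: sum.distrib inner_sum_left)
    finally have "\<phi> y \<le> 1 / ?m * ((\<Sum>i\<in>UNIV. f i xstar) + (\<Sum>i\<in>UNIV. gradient (f i) xstar) \<bullet> (y - xstar)
        + ?m * (L / 2 * (norm (y - xstar))\<^sup>2))"
      unfolding \<phi>_def by (intro mult_left_mono) auto
    also have "\<dots> = \<phi> xstar + p \<bullet> (y - xstar) + L / 2 * (norm (y - xstar))\<^sup>2"
      using m by (simp add: \<phi>_def p_def distrib_left)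
    finally show ?thesis .
  qed
  have "ereal (\<phi> xstar) + G xstar \<le> ereal (\<phi> y) + G y" for y
    using opt by (simp add: is_arg_min_linorder \<phi>_def)
  from arg_min_subgradient[OF G(1,3) this up] obtain a where a: "G xstar = ereal a"
    and "\<And>y b. G y = ereal b \<Longrightarrow> a \<le> b + p \<bullet> (y - xstar)" by blast
  then have sub: "a + (- p) \<bullet> (y - xstar) \<le> b" if "G y = ereal b" for y b using that by force
  define Xs :: "real^'d^'m" where "Xs = (\<chi> i. xstar)"
  define Zs :: "real^'d^'m" where "Zs = (\<chi> i. xstar + \<gamma> *\<^sub>R (- p))"
  \<comment> \<open>Chosen so that \<open>Xs\<close>, \<open>Zs\<close> and \<open>Ys\<close>
    satisfy the \<open>Z\<close>-update as a fixed point.\<close>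
  define Ys where "Ys = (B ** D) ** Xs - \<gamma> *\<^sub>R (B ** stacked_gradient f Xs) - Zs"
  have XZ: "norm (X k - Xs) \<le> norm (Z k - Zs)" for k
    unfolding X Xs_def Zs_def by (rule prox_sep_sum_dist_le[OF G \<gamma>(1) a sub])
  have psdC: "psd C" using C(1) by (simp add: loewner_le_def)
  then have symC: "symmetric_mat C" by (simp add: psd_def)
  have C1: "C *v 1 = 0" using C(3) span_base[of 1 "{1}"] by (auto simp: null_space_def)
  have col: "column j (\<chi> i. x) = (x $ j) *\<^sub>R 1" for j and x :: "real^'d"
    by (simp add: column_def vec_eq_iff)
  \<comment> \<open>All rows of \<open>Zs\<close> agree, so its columns are multiples of
    \<open>1\<close> and the \<open>Y\<close>-update leaves \<open>Ys\<close> fixed.\<close>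
  have CZs: "C ** Zs = 0"
  proof -
    have "column j (C ** Zs) = 0" for j
      unfolding column_matrix_mult Zs_def col by (simp add: matrix_vector_mult_scaleR C1)
    then show ?thesis by (simp add: column_def vec_eq_iff)
  qed
  have B1: "1 \<bullet> (B *v v) = 1 \<bullet> v" for v using B(2) by (simp flip: dot_lmul_matrix)
  \<comment> \<open>Both conditions on column sums enter: \<open>1 v* B = 1\<close> removes
    \<open>B\<close>, and \<open>1 \<bullet> (D *v 1)\<close> equals the number of rows, so the
    contributions of \<open>xstar\<close> and \<open>p\<close> cancel.\<close>
  have "1 \<bullet> column j (- Ys) = 0" for j
  proof -
    have one: "(1 :: real^'m) \<bullet> 1 = ?m" by (simp add: inner_vec_def)
    have c1: "1 \<bullet> column j ((B ** D) ** Xs) = ?m * xstar $ j"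
      unfolding matrix_mul_assoc[symmetric] column_matrix_mult B1
      unfolding Xs_def col by (simp add: matrix_vector_mult_scaleR D(4))
    have c2: "1 \<bullet> column j (B ** stacked_gradient f Xs) = ?m * p $ j"
      unfolding column_matrix_mult B1
      using m by (simp add: inner_vec_def column_def stacked_gradient_def Xs_def p_def)
    have c3: "1 \<bullet> column j Zs = ?m * (xstar $ j - \<gamma> * p $ j)"
      unfolding Zs_def col by (simp add: one)
    have cY: "column j (- Ys) = - (column j ((B ** D) ** Xs) - \<gamma> *\<^sub>R column j (B ** stacked_gradient f Xs) - column j Zs)"
      by (simp add: column_def vec_eq_iff Ys_def)
    show ?thesis
      unfolding cY inner_minus_right inner_diff_right inner_scaleR_right c1 c2 c3
      by (simp add: algebra_simps)
  qed
  then obtain U0 where U0: "C ** U0 = - Ys" using range_symmetric_mat[OF symC C(3)] by blast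
  \<comment> \<open>Summing the deviations of \<open>Z\<close> mirrors the \<open>Y\<close>-update,
    so \<open>C ** U k\<close> stays equal to \<open>Y k - Ys\<close> and \<open>U\<close> advances
    as in \<open>lyapunov_step\<close>.\<close>
  define U where "U k = U0 + (\<Sum>i<k. Z (Suc i) - Zs)" for k
  have USuc: "U (Suc k) = U k + (Z (Suc k) - Zs)" for k by (simp add: U_def add.assoc)
  have YU: "Y k - Ys = C ** U k" for k
  proof (induction k)
    case 0 show ?case by (simp add: Y0 U_def U0)
  next
    case (Suc k)
    then show ?case by (simp add: USuc Y matrix_add_ldistrib matrix_sub_ldistrib CZs algebra_simps)
  qed
  have "pd (mat 1 - C)" using C(2) by (simp add: loewner_less_def)
  then obtain W where W: "(mat 1 - C) ** W = mat 1" "W ** (mat 1 - C) = mat 1" "psd W"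
    and Wcomm: "\<And>P. P ** (mat 1 - C) = (mat 1 - C) ** P \<Longrightarrow> P ** W = W ** P"
    by (rule pd_inverse) blast
  have CW: "C ** W = W ** C" and BW: "B ** W = W ** B"
    by (rule Wcomm; simp add: matrix_sub_ldistrib matrix_sub_rdistrib BC)+
  have psdCW: "psd (C ** W)" by (rule psd_mult[OF psdC W(3) CW])
  have null: "dim (null_space C) = 1"
  proof -
    have "(1 :: real^'m) \<noteq> 0" by (simp add: vec_eq_iff)
    then show ?thesis by (simp add: C(3))
  qed
  define V where "V k = (norm (Z k - Zs))\<^sup>2 + U k \<bullet> (C ** (W ** U k))" for k
  let ?\<delta> = "rate \<mu> L C D \<gamma>"
  let ?T = "\<lambda>X. D ** X - \<gamma> *\<^sub>R stacked_gradient f X"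
  note l = lambda_min_bounds[OF D(1-3)]
  note ss = step_size_bounds[OF \<mu> L l \<gamma>[unfolded gamma_star_def]]
  have UCW: "0 \<le> U k \<bullet> (C ** (W ** U k))" for k
    using psd_inner_matrix[OF psdCW, of "U k"] by (simp add: matrix_mul_assoc)
  have ZX: "(norm (?T (X k) - ?T Xs))\<^sup>2 \<le> ?\<delta> * (norm (Z k - Zs))\<^sup>2" for k
  proof -
    have "norm (?T (X k) - ?T Xs) \<le> (1 - \<gamma> * \<mu>) * norm (X k - Xs)"
      by (rule gradient_step_lipschitz[OF sc sm D(1,3) \<gamma>(1) ss(2,1)])
    also have "\<dots> \<le> (1 - \<gamma> * \<mu>) * norm (Z k - Zs)"
      using XZ[of k] ss(2) by (intro mult_left_mono) auto
    finally have "(norm (?T (X k) - ?T Xs))\<^sup>2 \<le> ((1 - \<gamma> * \<mu>) * norm (Z k - Zs))\<^sup>2"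
      by (rule power_mono) simp
    also have "\<dots> = (1 - \<gamma> * \<mu>)\<^sup>2 * (norm (Z k - Zs))\<^sup>2" by (rule power_mult_distrib)
    also have "\<dots> \<le> ?\<delta> * (norm (Z k - Zs))\<^sup>2"
      using ss(3) by (intro mult_right_mono)
        (simp_all add: rate_def rate_at_gamma_star(3)[OF \<mu> L D(1-3) \<gamma>] le_max_iff_disj)
    finally show ?thesis .
  qed
  have VSuc: "V (Suc k) \<le> ?\<delta> * V k" for k
  proof -
    have eq: "Z (Suc k) - Zs = B ** (?T (X k) - ?T Xs) - C ** U k"
      unfolding YU[symmetric] Z Ys_def
      by (simp only: matrix_sub_ldistrib matrix_mul_assoc matrix_scalar_ac scalar_matrix_assoc)
         (simp add: algebra_simps)
    have "V (Suc k) \<le> (norm (?T (X k) - ?T Xs))\<^sup>2 + (1 - lambda_2 C) * (U k \<bullet> (C ** (W ** U k)))"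
      unfolding V_def USuc
      by (rule lyapunov_step[OF B(1) psdC null W CW BW BC eq])
    \<comment> \<open>Nonnegativity of the dual term allows \<open>1 - lambda_2 C\<close> to be
      raised to the common factor.\<close>
    also have "\<dots> \<le> ?\<delta> * (norm (Z k - Zs))\<^sup>2 + ?\<delta> * (U k \<bullet> (C ** (W ** U k)))"
      using ZX UCW by (intro add_mono mult_right_mono) (simp_all add: rate_def)
    finally show ?thesis by (simp add: V_def distrib_left)
  qed
  have \<delta>: "0 \<le> ?\<delta>" by (simp add: rate_def le_max_iff_disj)
  have Vk: "V k \<le> V 0 * ?\<delta> ^ k" for k
  proof (induction k)
    case (Suc k)
    have "V (Suc k) \<le> ?\<delta> * (V 0 * ?\<delta> ^ k)"
      using VSuc[of k] mult_left_mono[OF Suc \<delta>] by linarith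
    then show ?case by (simp add: mult_ac)
  qed simp
  have "(norm (X k - (\<chi> i. xstar)))\<^sup>2 \<le> V 0 * ?\<delta> ^ k" for k
  proof -
    have "(norm (X k - Xs))\<^sup>2 \<le> (norm (Z k - Zs))\<^sup>2" using XZ by (intro power_mono) auto
    also have "\<dots> \<le> V k" using UCW by (simp add: V_def)
    finally show ?thesis using Vk[of k] by (simp add: Xs_def)
  qed
  then show ?thesis by (rule that)
qed

theorem corollary19:
  fixes f :: "'m::finite \<Rightarrow> real^'d \<Rightarrow> real"
    and G :: "real^'d \<Rightarrow> ereal"
    and xstar :: "real^'d"
    and A B C D :: "real^'m^'m"
    and X Y Z :: "nat \<Rightarrow> real^'d^'m"
    and \<mu> L \<kappa> \<gamma> :: real
  assumes "CARD('m) \<ge> 2"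
    and "\<mu> > 0"
    and "\<And>i. strongly_convex \<mu> (f i)"
    and "\<And>i. L_smooth L (f i)"
    and "\<kappa> = L / \<mu>"
    and "proper_fun G" and "closed_fun G" and "convex_fun G"
    and "is_arg_min (\<lambda>x. ereal (1 / real CARD('m) * (\<Sum>i\<in>UNIV. f i x)) + G x) (\<lambda>_. True) xstar"
    and "symmetric_mat B" and "symmetric_mat C" and "symmetric_mat D"
    and "A = B ** D" and "0 \<prec>\<^sub>L D" and "D \<preceq>\<^sub>L mat 1"
    and "1 \<bullet> (D *v 1) = real CARD('m)" and "1 v* B = 1"
    and "0 \<preceq>\<^sub>L C" and "C \<prec>\<^sub>L mat 1" and "null_space C = span {1}"
    and "B ** C = C ** B"
    and "(q_factor \<mu> L D \<gamma>)\<^sup>2 *\<^sub>R (B ** B) \<prec>\<^sub>L mat 1 - C"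
    and "0 < \<gamma>" and "\<gamma> \<le> gamma_star \<mu> L D"
    and "B ** B \<preceq>\<^sub>L mat 1 - C"
    and "Y 0 = 0"
    and "\<And>k. X k = prox \<gamma> (sep_sum G) (Z k)"
    and "\<And>k. Z (Suc k) = A ** X k - \<gamma> *\<^sub>R (B ** stacked_gradient f (X k)) - Y k"
    and "\<And>k. Y (Suc k) = Y k + C ** Z (Suc k)"
  shows
    "((\<lambda>k. (norm (X k - (\<chi> i. xstar)))\<^sup>2) \<in> O(\<lambda>k. rate \<mu> L C D \<gamma> ^ k))
     \<and> (is_arg_min (rate \<mu> L C D) (\<lambda>\<gamma>'. 0 < \<gamma>' \<and> \<gamma>' \<le> gamma_star \<mu> L D) (gamma_star \<mu> L D)
        \<and> rate \<mu> L C D (gamma_star \<mu> L D)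
            = max (((\<kappa> - lambda_min D) / (\<kappa> + lambda_min D))\<^sup>2) (1 - lambda_2 C))
     \<and> (is_arg_min (\<lambda>D'. rate \<mu> L C D' (gamma_star \<mu> L D'))
          (\<lambda>D'. symmetric_mat D' \<and> 0 \<prec>\<^sub>L D' \<and> D' \<preceq>\<^sub>L mat 1
             \<and> 1 \<bullet> (D' *v 1) = real CARD('m)) (mat 1)
        \<and> gamma_star \<mu> L (mat 1 :: real^'m^'m) = 2 / (\<mu> + L)
        \<and> rate \<mu> L C (mat 1) (gamma_star \<mu> L (mat 1 :: real^'m^'m))
            = max (((\<kappa> - 1) / (\<kappa> + 1))\<^sup>2) (1 - lambda_2 C))"
proof (intro conjI)
  note sc = assms(3) and sm = assms(4) and \<kappa> = assms(5) and D = assms(12,14,15)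
  have \<mu>: "0 < \<mu>" "\<mu> \<le> L"
    using assms(2) strong_convexity_le_smoothness[OF sc sm] by blast+
  have rate0: "0 \<le> rate \<mu> L C D \<gamma>" by (simp add: rate_def le_max_iff_disj)
  obtain K where "\<And>k. (norm (X k - (\<chi> i. xstar)))\<^sup>2 \<le> K * rate \<mu> L C D \<gamma> ^ k"
    by (rule linear_convergence[OF \<mu>(1) sc sm assms(6-10,17) D assms(16,18-21,25,23,24,26,27)
          assms(28)[unfolded assms(13)] assms(29)]) blast
  then show "(\<lambda>k. (norm (X k - (\<chi> i. xstar)))\<^sup>2) \<in> O(\<lambda>k. rate \<mu> L C D \<gamma> ^ k)"
    \<comment> \<open>The constant in a Landau bound must be positive, while \<open>K\<close> may be
      0 or negative; hence \<open>max K 1\<close>.\<close>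
    using rate0 by (intro landau_o.bigI[of "max K 1"] always_eventually allI)
      (auto intro!: order_trans[OF _ mult_right_mono[OF max.cobounded1]])
  show "is_arg_min (rate \<mu> L C D) (\<lambda>\<gamma>'. 0 < \<gamma>' \<and> \<gamma>' \<le> gamma_star \<mu> L D) (gamma_star \<mu> L D)"
    using rate_at_gamma_star(2,4)[OF \<mu> D] by (auto simp: is_arg_min_linorder)
  show "rate \<mu> L C D (gamma_star \<mu> L D)
      = max (((\<kappa> - lambda_min D) / (\<kappa> + lambda_min D))\<^sup>2) (1 - lambda_2 C)"
    unfolding \<kappa> by (rule rate_at_gamma_star(1)[OF \<mu> D])
  have I: "symmetric_mat (mat 1 :: real^'m^'m)" "0 \<prec>\<^sub>L (mat 1 :: real^'m^'m)"
    "(mat 1 :: real^'m^'m) \<preceq>\<^sub>L mat 1"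
    using symmetric_mat_diff[of "mat 1 :: real^'m^'m" "mat 1"]
    by (simp_all add: loewner_less_def pd_def loewner_le_def psd_def)
  show rate1: "rate \<mu> L C (mat 1) (gamma_star \<mu> L (mat 1 :: real^'m^'m))
      = max (((\<kappa> - 1) / (\<kappa> + 1))\<^sup>2) (1 - lambda_2 C)"
    using rate_at_gamma_star(1)[OF \<mu> I] by (simp add: \<kappa>)
  have "1 \<le> \<kappa>" using \<mu> by (simp add: \<kappa>)
  \<comment> \<open>At the optimal step size the rate depends on \<open>D'\<close> only through
    \<open>lambda_min D'\<close>, in which the squared ratio is largest away from 1; the bound
    \<open>lambda_min D' \<le> 1\<close> makes the identity optimal.\<close>
  have "rate \<mu> L C (mat 1) (gamma_star \<mu> L (mat 1 :: real^'m^'m)) \<le> rate \<mu> L C D' (gamma_star \<mu> L D')"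
    if D': "symmetric_mat D'" "0 \<prec>\<^sub>L D'" "D' \<preceq>\<^sub>L mat 1" for D' :: "real^'m^'m"
    unfolding rate1 rate_at_gamma_star(1)[OF \<mu> D'] \<kappa>[symmetric]
    by (intro max.mono ratio_square_antimono lambda_min_bounds[OF D'] \<open>1 \<le> \<kappa>\<close> order_refl)
  then show "is_arg_min (\<lambda>D'. rate \<mu> L C D' (gamma_star \<mu> L D'))
      (\<lambda>D'. symmetric_mat D' \<and> 0 \<prec>\<^sub>L D' \<and> D' \<preceq>\<^sub>L mat 1
        \<and> 1 \<bullet> (D' *v 1) = real CARD('m)) (mat 1)"
    unfolding is_arg_min_linorder using I by (auto simp: inner_vec_def)
  show "gamma_star \<mu> L (mat 1 :: real^'m^'m) = 2 / (\<mu> + L)"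
    by (simp add: gamma_star_def add.commute)
qed

end
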